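(* Let $n\ge 1$, let $Q=\{Q_1,\ldots,Q_m\}$ be a partition of $\{1,\ldots,n\}$ into $m$ (nonempty) parts, let $F_m=\langle x_1,\ldots,x_m\rangle$ be the free group on $x_1,\ldots,x_m$, and let $t=(t_1,\ldots,t_n)\in F_m^n$ be the tuple with $t_i=x_s$ if and only if $i\in Q_s$. Then the Young subgroup $B_Q\subset B_n$ is equal to the stabilizer of $t$ under the Hurwitz action of $B_n$ on $F_m^n$.
   Context: $B_n$ is the braid group on $n$ strands with standard generators $\sigma_1,\ldots,\sigma_{n-1}$. For a group $G$, the Hurwitz action of $B_n$ on $G^n$ is the left action determined by $$\sigma_i(g_1,\ldots,g_i,g_{i+1},\ldots,g_n)=(g_1,\ldots,g_{i+1},\,g_{i+1}^{-1}g_ig_{i+1},\ldots,g_n)$$ (the entries $g_i,g_{i+1}$ in positions $i,i+1$ are replaced by $g_{i+1},\ g_{i+1}^{-1}g_ig_{i+1}$, the others are unchanged). For $1\le i<j\le n$ the Birman-Ko-Lee generator is $a_{ij}=\sigma_i\cdots\sigma_{j-2}\,\sigma_{j-1}\,\sigma_{j-2}^{-1}\cdots\sigma_i^{-1}\in B_n$. The Young subgroup $B_Q$ of $B_n$ associated to a partition $Q=\{Q_1,\ldots,Q_m\}$ of $\{1,\ldots,n\}$ is the subgroup generated by those $a_{ij}$ ($i<j$) for which $i$ and $j$ lie in the same part of $Q$. *)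

theory Defs
  imports "HOL-Algebra.Group_Action" "HOL-Algebra.Generated_Groups" "HOL-Library.Disjoint_Sets" "HOL-Library.FuncSet"
begin

section \<open>Groups given by generators and relations\<close>

text \<open>A letter \<open>(x, True)\<close> stands for the generator \<open>x\<close>, and \<open>(x, False)\<close> for its formal inverse.\<close>

type_synonym 'a word = "('a \<times> bool) list"

definition words :: "'a set \<Rightarrow> 'a word set"
  where "words X = lists (X \<times> UNIV)"

inductive pres_eq :: "'a set \<Rightarrow> ('a word \<times> 'a word) set \<Rightarrow> 'a word \<Rightarrow> 'a word \<Rightarrow> bool"
  for X :: "'a set" and R :: "('a word \<times> 'a word) set"
  where
    refl: "w \<in> words X \<Longrightarrow> pres_eq X R w w"
  | sym: "pres_eq X R v w \<Longrightarrow> pres_eq X R w v"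
  | trans: "pres_eq X R u v \<Longrightarrow> pres_eq X R v w \<Longrightarrow> pres_eq X R u w"
  | cancel: "u \<in> words X \<Longrightarrow> v \<in> words X \<Longrightarrow> x \<in> X \<Longrightarrow>
      pres_eq X R (u @ [(x, b), (x, \<not> b)] @ v) (u @ v)"
  | rel: "u \<in> words X \<Longrightarrow> v \<in> words X \<Longrightarrow> r \<in> words X \<Longrightarrow> s \<in> words X \<Longrightarrow> (r, s) \<in> R \<Longrightarrow>
      pres_eq X R (u @ r @ v) (u @ s @ v)"

definition word_class :: "'a set \<Rightarrow> ('a word \<times> 'a word) set \<Rightarrow> 'a word \<Rightarrow> 'a word set"
  where "word_class X R w = {v. pres_eq X R w v}"

definition presented_group :: "'a set \<Rightarrow> ('a word \<times> 'a word) set \<Rightarrow> 'a word set monoid"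
  where "presented_group X R =
    \<lparr>carrier = word_class X R ` words X,
     mult = \<lambda>A B. \<Union>a\<in>A. \<Union>b\<in>B. word_class X R (a @ b),
     one = word_class X R []\<rparr>"

lemma words_simps [simp]:
  "[] \<in> words X" "(p # w \<in> words X) = (fst p \<in> X \<and> w \<in> words X)"
  "(v @ w \<in> words X) = (v \<in> words X \<and> w \<in> words X)"
  by (auto simp: words_def mem_Times_iff)

lemma pres_eq_words: "pres_eq X R v w \<Longrightarrow> v \<in> words X \<and> w \<in> words X"
  by (induction rule: pres_eq.induct) auto

lemma pres_eq_context:
  assumes "pres_eq X R v w" "p \<in> words X" "q \<in> words X"
  shows "pres_eq X R (p @ v @ q) (p @ w @ q)"
  using assms
proof (induction rule: pres_eq.induct)
  case (cancel u v x b)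
  then show ?case using pres_eq.cancel[of "p @ u" X "v @ q" x R b] by simp
next
  case (rel u v r s)
  then show ?case using pres_eq.rel[of "p @ u" X "v @ q" r s R] by simp
qed (auto intro: pres_eq.intros)

lemma pres_eq_append:
  assumes "pres_eq X R v v'" "pres_eq X R w w'"
  shows "pres_eq X R (v @ w) (v' @ w')"
proof -
  have "pres_eq X R (v @ w) (v' @ w)"
    using pres_eq_context[OF assms(1), of "[]" w] pres_eq_words[OF assms(2)] by simp
  moreover have "pres_eq X R (v' @ w) (v' @ w')"
    using pres_eq_context[OF assms(2), of v' "[]"] pres_eq_words[OF assms(1)] by simp
  ultimately show ?thesis by (rule pres_eq.trans)
qed

lemma word_class_eq_iff:
  assumes "v \<in> words X"
  shows "word_class X R v = word_class X R w \<longleftrightarrow> pres_eq X R v w"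
proof
  assume "word_class X R v = word_class X R w"
  moreover have "v \<in> word_class X R v" using assms by (simp add: word_class_def pres_eq.refl)
  ultimately show "pres_eq X R v w" by (simp add: word_class_def pres_eq.sym)
next
  assume "pres_eq X R v w"
  then show "word_class X R v = word_class X R w"
    unfolding word_class_def by (blast intro: pres_eq.sym pres_eq.trans)
qed

lemma presented_group_mult:
  assumes "v \<in> words X" "w \<in> words X"
  shows "word_class X R v \<otimes>\<^bsub>presented_group X R\<^esub> word_class X R w = word_class X R (v @ w)"
proof -
  have same: "word_class X R (a @ b) = word_class X R (v @ w)"
    if "a \<in> word_class X R v" "b \<in> word_class X R w" for a b
  proof -
    have "pres_eq X R v a" "pres_eq X R w b" using that by (simp_all add: word_class_def)
    then have "pres_eq X R (v @ w) (a @ b)" by (rule pres_eq_append)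
    then show ?thesis using assms word_class_eq_iff[of "v @ w" X R "a @ b"] by simp
  qed
  have "v \<in> word_class X R v" "w \<in> word_class X R w"
    using assms by (auto simp: word_class_def intro: pres_eq.refl)
  then have nonempty: "word_class X R v \<noteq> {}" "word_class X R w \<noteq> {}" by blast+
  have "(\<Union>a\<in>word_class X R v. \<Union>b\<in>word_class X R w. word_class X R (a @ b)) =
      (\<Union>a\<in>word_class X R v. \<Union>b\<in>word_class X R w. word_class X R (v @ w))"
    by (intro SUP_cong HOL.refl same)
  also have "\<dots> = word_class X R (v @ w)" using nonempty by simp
  finally show ?thesis by (simp add: presented_group_def)
qed

lemma words_inverse [simp]: "rev (map (apsnd Not) w) \<in> words X \<longleftrightarrow> w \<in> words X"
  by (induction w) auto

lemma pres_eq_inverse: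
  assumes "w \<in> words X"
  shows "pres_eq X R (rev (map (apsnd Not) w) @ w) []"
  using assms
proof (induction w)
  case Nil
  then show ?case by (simp add: pres_eq.refl)
next
  case (Cons p w)
  obtain x b where p: "p = (x, b)" by (cases p)
  let ?v = "rev (map (apsnd Not) w)"
  have "?v \<in> words X" using Cons.prems by simp
  then have "pres_eq X R (?v @ [(x, \<not> b), (x, \<not> \<not> b)] @ w) (?v @ w)"
    using Cons.prems p by (intro pres_eq.cancel) auto
  then show ?case using Cons p by (auto intro: pres_eq.trans)
qed

lemma group_presented_group: "group (presented_group X R)"
proof (rule groupI)
  show "\<one>\<^bsub>presented_group X R\<^esub> \<in> carrier (presented_group X R)"
    by (simp add: presented_group_def)
next
  fix A assume "A \<in> carrier (presented_group X R)"
  then obtain w where w: "A = word_class X R w" "w \<in> words X" by (auto simp: presented_group_def)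
  have one: "\<one>\<^bsub>presented_group X R\<^esub> = word_class X R []" by (simp add: presented_group_def)
  show "\<one>\<^bsub>presented_group X R\<^esub> \<otimes>\<^bsub>presented_group X R\<^esub> A = A"
    using w by (simp add: one presented_group_mult)
  let ?v = "rev (map (apsnd Not) w)"
  have v: "?v \<in> words X" using w by simp
  have "word_class X R ?v \<otimes>\<^bsub>presented_group X R\<^esub> A = \<one>\<^bsub>presented_group X R\<^esub>"
    using w v pres_eq_inverse[of w X R] word_class_eq_iff[of "?v @ w" X R "[]"]
    by (simp add: one presented_group_mult)
  then show "\<exists>B\<in>carrier (presented_group X R).
      B \<otimes>\<^bsub>presented_group X R\<^esub> A = \<one>\<^bsub>presented_group X R\<^esub>"
    by (rule bexI) (use v in \<open>simp add: presented_group_def\<close>)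
next
  fix A B assume "A \<in> carrier (presented_group X R)" "B \<in> carrier (presented_group X R)"
  then obtain v w where "A = word_class X R v" "v \<in> words X" "B = word_class X R w" "w \<in> words X"
    by (auto simp: presented_group_def)
  then show "A \<otimes>\<^bsub>presented_group X R\<^esub> B \<in> carrier (presented_group X R)"
    by (simp add: presented_group_mult) (simp add: presented_group_def)
next
  fix A B C
  assume "A \<in> carrier (presented_group X R)" "B \<in> carrier (presented_group X R)"
    "C \<in> carrier (presented_group X R)"
  then obtain u v w where "A = word_class X R u" "u \<in> words X"
    "B = word_class X R v" "v \<in> words X" "C = word_class X R w" "w \<in> words X"
    by (auto simp: presented_group_def)
  then show "A \<otimes>\<^bsub>presented_group X R\<^esub> B \<otimes>\<^bsub>presented_group X R\<^esub> C =
      A \<otimes>\<^bsub>presented_group X R\<^esub> (B \<otimes>\<^bsub>presented_group X R\<^esub> C)"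
    by (simp add: presented_group_mult)
qed


section \<open>Free groups\<close>

definition free_group :: "'a set \<Rightarrow> 'a word set monoid"
  where "free_group X = presented_group X {}"

definition free_gen :: "'a set \<Rightarrow> 'a \<Rightarrow> 'a word set"
  where "free_gen X x = word_class X {} [(x, True)]"

lemma group_free_group: "group (free_group X)"
  by (simp add: free_group_def group_presented_group)

lemma free_gen_closed: "x \<in> X \<Longrightarrow> free_gen X x \<in> carrier (free_group X)"
  by (auto simp: free_gen_def free_group_def presented_group_def)

lemma free_gen_inj: "inj_on (free_gen X) X"
proof (rule inj_onI)
  fix x y assume "x \<in> X" "y \<in> X" and eq: "free_gen X x = free_gen X y"
  define e where "e w = (\<Sum>p\<leftarrow>w. if fst p = x then if snd p then 1 else -1 else (0 :: int))" for w
  have inv: "e v = e w" if "pres_eq X {} v w" for v w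
    using that by (induction rule: pres_eq.induct) (auto simp: e_def)
  have "pres_eq X {} [(x, True)] [(y, True)]"
    using eq \<open>x \<in> X\<close> by (simp add: free_gen_def word_class_eq_iff)
  from inv[OF this] show "x = y" by (auto simp: e_def split: if_splits)
qed


section \<open>Braid groups\<close>

definition braid_rels :: "nat \<Rightarrow> (nat word \<times> nat word) set"
  where "braid_rels n =
    {([(i, True), (j, True)], [(j, True), (i, True)]) | i j. 1 \<le> i \<and> i + 2 \<le> j \<and> j < n} \<union>
    {([(i, True), (i + 1, True), (i, True)], [(i + 1, True), (i, True), (i + 1, True)]) | i.
        1 \<le> i \<and> i + 1 < n}"

definition braid_group :: "nat \<Rightarrow> nat word set monoid"
  where "braid_group n = presented_group {1..<n} (braid_rels n)"

definition braid_class :: "nat \<Rightarrow> nat word \<Rightarrow> nat word set"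
  where "braid_class n w = word_class {1..<n} (braid_rels n) w"

definition braid_gen :: "nat \<Rightarrow> nat \<Rightarrow> nat word set"
  where "braid_gen n i = braid_class n [(i, True)]"

definition bkl_gen :: "nat \<Rightarrow> nat \<Rightarrow> nat \<Rightarrow> nat word set"
  where "bkl_gen n i j = braid_class n
    (map (\<lambda>k. (k, True)) [i..<j - 1] @ [(j - 1, True)] @ map (\<lambda>k. (k, False)) (rev [i..<j - 1]))"

definition young_subgroup :: "nat \<Rightarrow> nat set set \<Rightarrow> nat word set set"
  where "young_subgroup n P = generate (braid_group n)
    {bkl_gen n i j | i j. 1 \<le> i \<and> i < j \<and> j \<le> n \<and> (\<exists>A\<in>P. i \<in> A \<and> j \<in> A)}"

lemma group_braid_group: "group (braid_group n)"
  by (simp add: braid_group_def group_presented_group)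

lemma braid_class_closed: "w \<in> words {1..<n} \<Longrightarrow> braid_class n w \<in> carrier (braid_group n)"
  by (auto simp: braid_class_def braid_group_def presented_group_def)

lemma braid_class_mult:
  "v \<in> words {1..<n} \<Longrightarrow> w \<in> words {1..<n} \<Longrightarrow>
    braid_class n v \<otimes>\<^bsub>braid_group n\<^esub> braid_class n w = braid_class n (v @ w)"
  by (simp add: braid_class_def braid_group_def presented_group_mult)


section \<open>The Hurwitz action\<close>

definition tuples :: "nat \<Rightarrow> ('g, 'b) monoid_scheme \<Rightarrow> (nat \<Rightarrow> 'g) set"
  where "tuples n G = {1..n} \<rightarrow>\<^sub>E carrier G"

fun hurwitz_letter :: "('g, 'b) monoid_scheme \<Rightarrow> nat \<times> bool \<Rightarrow> (nat \<Rightarrow> 'g) \<Rightarrow> nat \<Rightarrow> 'g"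
  where
    "hurwitz_letter G (i, True) g =
      g(i := g (i + 1), i + 1 := inv\<^bsub>G\<^esub> g (i + 1) \<otimes>\<^bsub>G\<^esub> g i \<otimes>\<^bsub>G\<^esub> g (i + 1))"
  | "hurwitz_letter G (i, False) g =
      g(i := g i \<otimes>\<^bsub>G\<^esub> g (i + 1) \<otimes>\<^bsub>G\<^esub> inv\<^bsub>G\<^esub> g i, i + 1 := g i)"

text \<open>For a left action, the rightmost letter of a word acts first.\<close>

definition hurwitz_word :: "('g, 'b) monoid_scheme \<Rightarrow> nat word \<Rightarrow> (nat \<Rightarrow> 'g) \<Rightarrow> nat \<Rightarrow> 'g"
  where "hurwitz_word G w = foldr (hurwitz_letter G) w"

text \<open>The choice of a representing word does not matter, by \<open>hurwitz_action_class\<close> below;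
  \<open>hurwitz_group_action\<close> and \<open>hurwitz_action_gen\<close> show that this is the action in question.\<close>

definition hurwitz_action ::
    "nat \<Rightarrow> ('g, 'b) monoid_scheme \<Rightarrow> nat word set \<Rightarrow> (nat \<Rightarrow> 'g) \<Rightarrow> nat \<Rightarrow> 'g"
  where "hurwitz_action n G \<beta> = (\<lambda>g\<in>tuples n G. hurwitz_word G (SOME w. w \<in> \<beta>) g)"

lemma hurwitz_word_append:
  "hurwitz_word G (v @ w) g = hurwitz_word G v (hurwitz_word G w g)"
  by (simp add: hurwitz_word_def)

context group
begin

lemma hurwitz_letter_closed:
  assumes "g \<in> tuples n G" "fst p \<in> {1..<n}"
  shows "hurwitz_letter G p g \<in> tuples n G"
proof -
  obtain i b where "p = (i, b)" by (cases p)
  with assms show ?thesis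
    by (cases b) (auto simp: tuples_def PiE_iff extensional_def)
qed

lemma hurwitz_word_closed:
  "w \<in> words {1..<n} \<Longrightarrow> g \<in> tuples n G \<Longrightarrow> hurwitz_word G w g \<in> tuples n G"
  by (induction w) (simp_all add: hurwitz_word_def hurwitz_letter_closed)

lemma hurwitz_letter_cancel:
  assumes "g \<in> tuples n G" "i \<in> {1..<n}"
  shows "hurwitz_letter G (i, b) (hurwitz_letter G (i, \<not> b) g) = g"
proof -
  have [simp]: "g i \<in> carrier G" "g (Suc i) \<in> carrier G"
    using assms by (auto simp: tuples_def PiE_iff)
  have c: "x \<otimes> (inv x \<otimes> y) = y" "inv x \<otimes> (x \<otimes> y) = y" if "x \<in> carrier G" "y \<in> carrier G" for x y
    using that by (simp_all flip: m_assoc)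
  show ?thesis
    by (cases b) (auto simp: fun_eq_iff m_assoc c)
qed

lemma hurwitz_rel:
  assumes "g \<in> tuples n G" "(r, s) \<in> braid_rels n"
  shows "hurwitz_word G r g = hurwitz_word G s g"
proof -
  have g: "g k \<in> carrier G" if "1 \<le> k" "k \<le> n" for k
    using assms(1) that by (auto simp: tuples_def PiE_iff)
  have c: "x \<otimes> (inv x \<otimes> y) = y" "inv x \<otimes> (x \<otimes> y) = y" if "x \<in> carrier G" "y \<in> carrier G" for x y
    using that by (simp_all flip: m_assoc)
  from assms(2) consider
    i j where "1 \<le> i" "i + 2 \<le> j" "j < n" "r = [(i, True), (j, True)]" "s = [(j, True), (i, True)]"
  | i where "1 \<le> i" "i + 1 < n" "r = [(i, True), (i + 1, True), (i, True)]"
      "s = [(i + 1, True), (i, True), (i + 1, True)]"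
    by (auto simp: braid_rels_def)
  then show ?thesis
  proof cases
    case 1
    then show ?thesis by (auto simp: hurwitz_word_def fun_eq_iff)
  next
    case 2
    then have "g i \<in> carrier G" "g (Suc i) \<in> carrier G" "g (Suc (Suc i)) \<in> carrier G"
      by (auto intro!: g)
    then show ?thesis using 2 by (auto simp: hurwitz_word_def fun_eq_iff m_assoc c inv_mult_group)
  qed
qed

lemma hurwitz_word_pres_eq:
  assumes "pres_eq {1..<n} (braid_rels n) v w" "g \<in> tuples n G"
  shows "hurwitz_word G v g = hurwitz_word G w g"
  using assms
proof (induction arbitrary: g rule: pres_eq.induct)
  case (cancel u v x b)
  have "hurwitz_word G [(x, b), (x, \<not> b)] h = h" if "h \<in> tuples n G" for h
    using hurwitz_letter_cancel[OF that cancel(3), of b] by (simp add: hurwitz_word_def)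
  then show ?case using cancel by (simp only: hurwitz_word_append hurwitz_word_closed)
next
  case (rel u v r s)
  then show ?case by (simp add: hurwitz_word_append hurwitz_rel[OF hurwitz_word_closed])
qed auto

lemma hurwitz_action_class:
  assumes "w \<in> words {1..<n}" "g \<in> tuples n G"
  shows "hurwitz_action n G (braid_class n w) g = hurwitz_word G w g"
proof -
  let ?v = "SOME v. v \<in> braid_class n w"
  have "w \<in> braid_class n w"
    using assms(1) by (simp add: braid_class_def word_class_def pres_eq.refl)
  then have "?v \<in> braid_class n w" by (rule someI)
  then have "pres_eq {1..<n} (braid_rels n) w ?v" by (simp add: braid_class_def word_class_def)
  from hurwitz_word_pres_eq[OF this assms(2)] show ?thesis
    using assms(2) by (simp add: hurwitz_action_def)
qed

lemma hurwitz_action_gen: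
  assumes "1 \<le> i" "i < n" "g \<in> tuples n G"
  shows "hurwitz_action n G (braid_gen n i) g =
    g(i := g (i + 1), i + 1 := inv g (i + 1) \<otimes> g i \<otimes> g (i + 1))"
  using assms by (simp add: braid_gen_def hurwitz_action_class hurwitz_word_def)

lemma hurwitz_group_action: "group_action (braid_group n) (tuples n G) (hurwitz_action n G)"
proof -
  let ?B = "braid_group n" and ?E = "tuples n G" and ?h = "hurwitz_action n G"
  interpret B: group ?B by (rule group_braid_group)
  have rep: "\<exists>w\<in>words {1..<n}. \<beta> = braid_class n w" if "\<beta> \<in> carrier ?B" for \<beta>
    using that by (auto simp: braid_group_def presented_group_def braid_class_def)
  have closed: "?h \<beta> g \<in> ?E" if "\<beta> \<in> carrier ?B" "g \<in> ?E" for \<beta> g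
    using rep[OF that(1)] that(2) by (auto simp: hurwitz_action_class hurwitz_word_closed)
  have mult: "?h (\<beta> \<otimes>\<^bsub>?B\<^esub> \<gamma>) g = ?h \<beta> (?h \<gamma> g)"
    if "\<beta> \<in> carrier ?B" "\<gamma> \<in> carrier ?B" "g \<in> ?E" for \<beta> \<gamma> g
    using rep[OF that(1)] rep[OF that(2)] that(3)
    by (auto simp: braid_class_mult hurwitz_action_class hurwitz_word_closed hurwitz_word_append)
  have one: "?h \<one>\<^bsub>?B\<^esub> g = g" if "g \<in> ?E" for g
  proof -
    have "\<one>\<^bsub>?B\<^esub> = braid_class n []"
      by (simp add: braid_group_def presented_group_def braid_class_def)
    then show ?thesis using that by (simp add: hurwitz_action_class hurwitz_word_def)
  qed
  have bij: "?h \<beta> \<in> Bij ?E" if "\<beta> \<in> carrier ?B" for \<beta>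
  proof -
    have "bij_betw (?h \<beta>) ?E ?E"
      by (rule bij_betw_byWitness[where f' = "?h (inv\<^bsub>?B\<^esub> \<beta>)"])
        (use that in \<open>auto simp: closed one simp flip: mult\<close>)
    then show ?thesis by (simp add: Bij_def hurwitz_action_def)
  qed
  have "?h (\<beta> \<otimes>\<^bsub>?B\<^esub> \<gamma>) = compose ?E (?h \<beta>) (?h \<gamma>)"
    if "\<beta> \<in> carrier ?B" "\<gamma> \<in> carrier ?B" for \<beta> \<gamma>
  proof (rule extensionalityI)
    show "?h (\<beta> \<otimes>\<^bsub>?B\<^esub> \<gamma>) \<in> extensional ?E" by (simp add: hurwitz_action_def)
  qed (use that in \<open>auto simp: mult compose_eq\<close>)
  then show ?thesis
    using bij
    by (auto intro!: group_action.intro group_hom.intro group_hom_axioms.intro homI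
        group_BijGroup group_braid_group simp: BijGroup_def)
qed

end

end

theory Submission
  imports Defs Complex_Main
begin

text \<open>
  Lift the tuple \<open>t\<close> to the tuple \<open>(x\<^sub>1, \<dots>, x\<^sub>n)\<close> of distinct generators of a free group; a braid \<open>\<beta>\<close> moves it to
  a tuple \<open>g\<close> of conjugates of generators, which are the loops around a system of disjoint arcs in the
  punctured disc. This planarity is expressed by a left-invariant cyclic order on the free group, obtained from
  a ping-pong action by Moebius transformations: no two translates of the chords \<open>(1, g\<^sub>k)\<close> are linked.

  Suppose that \<open>\<beta>\<close> fixes \<open>t\<close>. If some reduced word \<open>g\<^sub>k\<close> is not reduced after identifying generators of the same
  colour, it contains adjacent letters \<open>x\<^sub>i\<^sup>\<plusminus>\<^sup>1 x\<^sub>j\<^sup>\<mp>\<^sup>1\<close> with \<open>i, j\<close> in one part. Since no arc crosses the chord between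
  these two letters, the substitution effected by the half twist \<open>a\<^sub>i\<^sub>j\<close> or its inverse can be carried out letter by
  letter, and it makes that adjacent pair cancel. Hence multiplying \<open>\<beta>\<close> on the right by \<open>a\<^sub>i\<^sub>j\<^sup>\<plusminus>\<^sup>1\<close> decreases the total length
  of \<open>g\<close>. If there is no such pair, then \<open>g\<close> is the tuple \<open>(x\<^sub>1, \<dots>, x\<^sub>n)\<close> itself, and \<open>\<beta> = 1\<close> because the
  Hurwitz action is free on this tuple (Artin). The latter is shown by peak reduction: every braid is reached
  from \<open>1\<close> by a length-increasing path.
\<close>

section \<open>Reduced words\<close>

text \<open>Hurwitz moves commute with homomorphisms applied entrywise. So, while a factor on the
  left of a braid acts by local moves, a factor on the right acts by substituting words for the
  generators; and the tuple of colours is the image of the tuple of distinct generators. The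
  obstacle is that the substitution of \<open>a\<^sub>i\<^sub>j\<close> tends to lengthen words:
  generators strictly between \<open>i\<close> and \<open>j\<close> are conjugated by a two-letter
  word. Planarity removes it, because the conjugating factors of neighbouring letters cancel as long
  as no chord crosses the arc. Planarity is needed a second time in the peak reduction: two
  shortening moves at adjacent places are joined by a hexagon of shorter tuples, except when the
  outer entries lie beyond the middle one on two opposite sides, and the cyclic order excludes this.
  An order on group elements replaces the topology of arcs by inequalities between real numbers that
  can be checked for one Hurwitz move at a time. The parabolic maps come from hyperbolic geometry,
  where a loop around a puncture acts as a parabolic isometry.\<close>

fun flip :: "nat \<times> bool \<Rightarrow> nat \<times> bool"
  where "flip (k, b) = (k, \<not> b)"

lemma flip_flip [simp]: "flip (flip p) = p"
  by (cases p) simp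

lemma fst_flip [simp]: "fst (flip p) = fst p"
  by (cases p) simp

definition winv :: "nat word \<Rightarrow> nat word"
  where "winv w = rev (map flip w)"

lemma winv_simps [simp]:
  "winv [] = []" "winv (p # w) = winv w @ [flip p]" "winv (v @ w) = winv w @ winv v"
  "winv (winv w) = w" "length (winv w) = length w" "winv w = [] \<longleftrightarrow> w = []"
  by (simp_all add: winv_def rev_map comp_def)

abbreviation reduced :: "nat word \<Rightarrow> bool"
  where "reduced \<equiv> successively (\<lambda>p q. q \<noteq> flip p)"

lemma reduced_winv [simp]: "reduced (winv w) \<longleftrightarrow> reduced w"
proof -
  have "reduced (winv w)" if "reduced w" for w
    using that by (simp add: winv_def successively_map) (metis (mono_tags, lifting) flip_flip successively_mono)
  then show ?thesis by (metis winv_simps(4))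
qed

lemma reduced_append:
  "reduced (v @ w) \<longleftrightarrow> reduced v \<and> reduced w \<and> (v = [] \<or> w = [] \<or> hd w \<noteq> flip (last v))"
  by (auto simp: successively_append_iff)

lemma reduced_Cons: "reduced (p # w) \<longleftrightarrow> reduced w \<and> (w = [] \<or> hd w \<noteq> flip p)"
  by (auto simp: successively_Cons)

fun push :: "nat \<times> bool \<Rightarrow> nat word \<Rightarrow> nat word"
  where
    "push p [] = [p]"
  | "push p (q # w) = (if q = flip p then w else p # q # w)"

definition red :: "nat word \<Rightarrow> nat word"
  where "red w = foldr push w []"

lemma reduced_push: "reduced w \<Longrightarrow> reduced (push p w)"
  by (cases w) (auto simp: successively_Cons)

lemma push_eq_Cons: "reduced (p # w) \<Longrightarrow> push p w = p # w"
  by (cases w) auto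

text \<open>Van der Waerden's argument: a letter and its flip act on the reduced words by inverse
  permutations. So \<open>red\<close>, which lets a word act on the empty word, depends only on the
  group element, and confluence of rewriting need not be proved.\<close>

lemma push_flip: "reduced w \<Longrightarrow> push p (push (flip p) w) = w"
  by (cases w) (auto simp: push_eq_Cons)

lemma red_simps [simp]: "red [] = []" "red (p # w) = push p (red w)"
  by (simp_all add: red_def)

lemma reduced_red [simp]: "reduced (red w)"
  by (induction w) (auto simp: reduced_push)

lemma red_reduced: "reduced w \<Longrightarrow> red w = w"
  by (induction w) (auto simp: push_eq_Cons reduced_Cons)

lemma reduced_foldr_push: "reduced w \<Longrightarrow> reduced (foldr push v w)"
  by (induction v) (auto simp: reduced_push)

lemma red_append: "red (v @ w) = foldr push v (red w)"
  by (simp add: red_def)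

text \<open>A cancellation inside \<open>push p s\<close> does not change the action, since the two
  cancelled letters act inversely. Hence \<open>red v\<close> acts like \<open>v\<close>.\<close>

lemma foldr_push_push:
  assumes "reduced w" "reduced s"
  shows "foldr push (push p s) w = push p (foldr push s w)"
proof (cases s)
  case (Cons q t)
  have "reduced (foldr push t w)" using assms by (simp add: reduced_foldr_push)
  from push_flip[OF this, of p] show ?thesis using Cons by auto
qed simp

lemma red_append_red1 [simp]: "red (red v @ w) = red (v @ w)"
proof -
  have "foldr push (red v) (red w) = foldr push v (red w)"
    by (induction v) (simp_all add: foldr_push_push)
  then show ?thesis by (simp add: red_append)
qed

lemma red_append_red2 [simp]: "red (v @ red w) = red (v @ w)"
  by (simp add: red_append red_reduced)

lemma red_cancel [simp]: "red (u @ p # flip p # v) = red (u @ v)"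
  by (simp add: red_append push_flip)

lemma red_winv [simp]: "red (winv w @ w) = []"
proof (induction w)
  case (Cons p w)
  have "red (winv w @ flip p # flip (flip p) # w) = red (winv w @ w)" by (rule red_cancel)
  then show ?case using Cons by simp
qed simp

lemma length_push: "length (push p w) \<le> Suc (length w)"
  by (cases w) auto

lemma length_red: "length (red w) \<le> length w"
proof (induction w)
  case (Cons p w)
  then show ?case using length_push[of p "red w"] by simp
qed simp

lemma length_red_less: "\<not> reduced w \<Longrightarrow> length (red w) < length w"
proof (induction w)
  case (Cons p w)
  show ?case
  proof (cases "reduced w")
    case True
    with Cons.prems have "w \<noteq> []" "hd w = flip p" by (auto simp: reduced_Cons)
    then show ?thesis using True using red_cancel[of "[]" p "tl w"] length_red[of "tl w"] by (cases w) auto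
  next
    case False
    with Cons.IH length_push[of p "red w"] show ?thesis by simp
  qed
qed simp

lemma set_push: "set (push p w) \<subseteq> insert p (set w)"
  by (cases w) auto

lemma set_red: "set (red w) \<subseteq> set w"
proof (induction w)
  case (Cons p w)
  then show ?case using set_push[of p "red w"] by auto
qed simp

lemma pres_eq_red:
  assumes "pres_eq X {} v w"
  shows "red v = red w"
  using assms
proof (induction rule: pres_eq.induct)
  case (cancel u v x b)
  then show ?case using red_cancel[of u "(x, b)" v] by simp
qed auto


section \<open>The free group on the natural numbers, written additively\<close>

text \<open>A type of class \<open>group_add\<close> makes the simplifier's group laws available.
  All naturals serve as letters, so that the same type is used for the generators of the strands and
  for those of the colours.\<close>

typedef fgrp = "{w :: nat word. reduced w}" morphisms rep abs_fgrp
  by (rule exI[of _ "[]"]) simp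

definition of_word :: "nat word \<Rightarrow> fgrp"
  where "of_word w = abs_fgrp (red w)"

lemma reduced_rep [simp]: "reduced (rep a)"
  using rep by simp

lemma rep_of_word [simp]: "rep (of_word w) = red w"
  by (simp add: of_word_def abs_fgrp_inverse)

lemma red_rep [simp]: "red (rep a) = rep a"
  by (simp add: red_reduced)

lemma of_word_rep [simp]: "of_word (rep a) = a"
  by (simp add: of_word_def rep_inverse)

lemma of_word_eq_iff: "of_word v = of_word w \<longleftrightarrow> red v = red w"
  by (metis rep_of_word rep_inject)

lemma of_word_red [simp]: "of_word (red w) = of_word w"
  by (simp add: of_word_eq_iff red_reduced)

instantiation fgrp :: group_add
begin

definition "0 = of_word []"
definition "a + b = of_word (rep a @ rep b)"
definition "- a = of_word (winv (rep a))"
definition "a - b = a + - (b :: fgrp)"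

instance
proof
  fix a b c :: fgrp
  show "a + b + c = a + (b + c)" by (simp add: plus_fgrp_def of_word_eq_iff)
  show "0 + a = a" by (simp add: plus_fgrp_def zero_fgrp_def)
  show "a + 0 = a" unfolding plus_fgrp_def zero_fgrp_def by simp
  show "- a + a = 0" by (simp add: plus_fgrp_def zero_fgrp_def uminus_fgrp_def of_word_eq_iff)
  show "a + - b = a - b" by (simp add: minus_fgrp_def)
qed

end

lemma rep_0 [simp]: "rep 0 = []"
  by (simp add: zero_fgrp_def)

lemma of_word_Nil [simp]: "of_word [] = 0"
  by (simp add: zero_fgrp_def)

lemma of_word_append: "of_word (v @ w) = of_word v + of_word w"
  by (simp add: plus_fgrp_def of_word_eq_iff)

lemma of_word_Cons: "of_word (p # w) = of_word [p] + of_word w"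
  using of_word_append[of "[p]" w] by simp

lemma of_word_winv: "of_word (winv w) = - of_word w"
proof -
  have "of_word (winv w) + of_word w = 0"
    by (metis of_word_append of_word_Nil of_word_eq_iff red_simps(1) red_winv)
  then show ?thesis by (simp add: eq_neg_iff_add_eq_0)
qed

lemma of_word_flip: "of_word [flip p] = - of_word [p]"
  using of_word_winv[of "[p]"] by simp

lemma rep_eq_Nil [simp]: "rep a = [] \<longleftrightarrow> a = 0"
  by (metis rep_0 rep_inject)

lemma rep_add: "rep (a + b) = red (rep a @ rep b)"
  by (simp add: plus_fgrp_def)

lemma rep_minus [simp]: "rep (- a) = winv (rep a)"
  by (simp add: uminus_fgrp_def red_reduced)

lemma of_wordD: "rep a = w \<Longrightarrow> a = of_word w"
  by auto

definition gen :: "nat \<Rightarrow> fgrp"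
  where "gen k = of_word [(k, True)]"

lemma rep_gen [simp]: "rep (gen k) = [(k, True)]"
  by (simp add: gen_def)

lemma of_word_letter: "of_word [(k, b)] = (if b then gen k else - gen k)"
  using of_word_flip[of "(k, True)"] by (simp add: gen_def)

lemma fgrp_induct [case_names zero letter]:
  assumes "P 0" "\<And>p a. P a \<Longrightarrow> P (of_word [p] + a)"
  shows "P a"
proof -
  have "P (of_word w)" for w
  proof (induction w)
    case (Cons p w)
    then show ?case using assms(2) of_word_Cons by metis
  qed (simp add: assms(1))
  then show ?thesis by (metis of_word_rep)
qed


section \<open>Homomorphisms out of the free group\<close>

definition evw :: "(nat \<Rightarrow> 'a::group_add) \<Rightarrow> nat word \<Rightarrow> 'a"
  where "evw f w = (\<Sum>p\<leftarrow>w. if snd p then f (fst p) else - f (fst p))"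

definition ev :: "(nat \<Rightarrow> 'a::group_add) \<Rightarrow> fgrp \<Rightarrow> 'a"
  where "ev f a = evw f (rep a)"

lemma evw_simps [simp]:
  "evw f [] = 0" "evw f (p # w) = (if snd p then f (fst p) else - f (fst p)) + evw f w"
  "evw f (v @ w) = evw f v + evw f w"
  by (simp_all add: evw_def)

lemma evw_red [simp]: "evw f (red w) = evw f w"
proof (induction w)
  case (Cons p w)
  have "evw f (push p v) = evw f (p # v)" for v
    by (cases v; cases p) (auto simp flip: add.assoc)
  with Cons show ?case by simp
qed simp

lemma ev_0 [simp]: "ev f 0 = 0"
  by (simp add: ev_def)

lemma ev_add [simp]: "ev f (a + b) = ev f a + ev f b"
  by (simp add: ev_def rep_add)

lemma ev_minus [simp]: "ev f (- a) = - ev f a"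
  using ev_add[of f "- a" a] by (simp add: eq_neg_iff_add_eq_0 del: ev_add)

lemma ev_diff [simp]: "ev f (a - b) = ev f a - ev f b"
  by (simp only: diff_conv_add_uminus ev_add ev_minus)

lemma ev_gen [simp]: "ev f (gen k) = f k"
  by (simp add: ev_def)

text \<open>The half twist found from two letters of an entry must be a braid on \<open>n\<close>
  strands, so the letters that occur are tracked along the Hurwitz moves.\<close>

definition letters_in :: "nat set \<Rightarrow> fgrp set"
  where "letters_in X = {a. fst ` set (rep a) \<subseteq> X}"

lemma letters_in_add: "a \<in> letters_in X \<Longrightarrow> b \<in> letters_in X \<Longrightarrow> a + b \<in> letters_in X"
  using order.trans[OF image_mono[OF set_red[of "rep a @ rep b"], of fst], of X]
  by (simp add: letters_in_def rep_add image_Un)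

lemma letters_in_minus: "a \<in> letters_in X \<Longrightarrow> - a \<in> letters_in X"
  by (auto simp: letters_in_def winv_def)

lemma letters_in_gen: "k \<in> X \<Longrightarrow> gen k \<in> letters_in X"
  by (simp add: letters_in_def)

section \<open>Left-invariant cyclic orders\<close>

definition cyc :: "real \<Rightarrow> real \<Rightarrow> real \<Rightarrow> bool"
  where "cyc x y z \<longleftrightarrow> x < y \<and> y < z \<or> y < z \<and> z < x \<or> z < x \<and> x < y"

text \<open>Strict crossing of two chords of a circle. Chords with a common endpoint are not linked,
  which is why coinciding points need arguments of their own below.\<close>

definition linked :: "real \<Rightarrow> real \<Rightarrow> real \<Rightarrow> real \<Rightarrow> bool"
  where "linked x y z w \<longleftrightarrow> cyc x z y \<and> cyc y w x \<or> cyc x w y \<and> cyc y z x"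

lemma linked_commute: "linked x y z w \<longleftrightarrow> linked z w x y"
  unfolding linked_def cyc_def by (smt (verit))

lemma linked_swap: "linked x y z w \<longleftrightarrow> linked y x z w" "linked x y z w \<longleftrightarrow> linked x y w z"
  unfolding linked_def cyc_def by (smt (verit))+

lemma not_linkedD:
  assumes "\<not> linked x y z w"
  shows "x < z \<Longrightarrow> z < y \<Longrightarrow> x \<le> w \<and> w \<le> y"
    and "x < w \<Longrightarrow> w < y \<Longrightarrow> x \<le> z \<and> z \<le> y"
  using assms by (auto simp: linked_def cyc_def)

lemma linked_less_iff:
  "x < y \<Longrightarrow> linked x y z w \<longleftrightarrow>
    (x < z \<and> z < y \<and> (w < x \<or> y < w)) \<or> (x < w \<and> w < y \<and> (z < x \<or> y < z))"
  unfolding linked_def cyc_def by (smt (verit))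

text \<open>The circle is cut open at the image of 0, its least point, so that statements on the
  cyclic order become linear inequalities between reals.\<close>

locale cyclic_order =
  fixes P :: "'a::group_add \<Rightarrow> real"
  assumes P_0 [simp]: "P 0 = 0"
    and P_pos: "a \<noteq> 0 \<Longrightarrow> 0 < P a"
    and P_inject [simp]: "P a = P b \<longleftrightarrow> a = b"
    and cyc_add: "cyc (P (h + a)) (P (h + b)) (P (h + c)) \<longleftrightarrow> cyc (P a) (P b) (P c)"
begin

lemma P_nonneg: "0 \<le> P a"
  using P_pos[of a] by (cases "a = 0") auto

lemma linked_add:
  "linked (P (h + a)) (P (h + b)) (P (h + c)) (P (h + d)) \<longleftrightarrow> linked (P a) (P b) (P c) (P d)"
  by (simp add: linked_def cyc_add)

definition unlinked :: "'a \<Rightarrow> 'a \<Rightarrow> bool"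
  where "unlinked a b \<longleftrightarrow> (\<forall>h. \<not> linked (P 0) (P a) (P h) (P (h + b)))"

lemma unlinkedD:
  assumes "unlinked a b"
  shows "\<not> linked (P g) (P (g + a)) (P h) (P (h + b))"
  using assms linked_add[of "- g" g "g + a" h "h + b"]
  by (simp add: unlinked_def flip: add.assoc)

lemma unlinkedI:
  assumes "\<And>h. \<not> linked (P g) (P (g + a)) (P h) (P (h + b))"
  shows "unlinked a b"
  unfolding unlinked_def
proof
  fix h
  show "\<not> linked (P 0) (P a) (P h) (P (h + b))"
    using assms[of "g + h"] linked_add[of g 0 a h "h + b"] by (simp add: add.assoc)
qed

lemma unlinked_commute: "unlinked a b \<Longrightarrow> unlinked b a"
  using unlinkedD[of a b] linked_commute unlinkedI[of 0] by metis

lemma unlinked_minus: "unlinked a b \<Longrightarrow> unlinked a (- b)"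
proof (rule unlinkedI[of 0])
  fix h assume "unlinked a b"
  from unlinkedD[OF this, of 0 "h - b"]
  show "\<not> linked (P 0) (P (0 + a)) (P h) (P (h + - b))"
    by (simp add: linked_swap(2)[of _ _ "P h"])
qed

text \<open>From the base point, the loops around disjoint arcs leave and return in the order
  \<open>g 1\<close>, \<open>- g 1\<close>, \<open>g 2\<close>, \<open>- g 2\<close> and so on. The
  case \<open>k = l\<close> of the last condition says that a loop does not cross its own
  translates.\<close>

definition admissible :: "nat \<Rightarrow> (nat \<Rightarrow> 'a) \<Rightarrow> bool"
  where "admissible n g \<longleftrightarrow>
    (\<forall>k\<in>{1..n}. P (g k) < P (- g k)) \<and>
    (\<forall>k\<in>{1..n}. \<forall>l\<in>{1..n}. k < l \<longrightarrow> P (- g k) < P (g l)) \<and>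
    (\<forall>k\<in>{1..n}. \<forall>l\<in>{1..n}. unlinked (g k) (g l))"

section \<open>The effect of one Hurwitz move on two adjacent entries\<close>

context
  fixes a b :: 'a
  assumes ab: "P a < P (- a)" "P (- a) < P b" "P b < P (- b)"
    and unl: "unlinked a a" "unlinked a b" "unlinked b b"
begin

lemma nonzero: "0 < P a" "0 < P b"
  using ab P_nonneg[of a] P_pos[of a] P_pos[of b] by (cases "a = 0"; auto)+

text \<open>Translation by \<open>a\<close> carries 0, \<open>- a\<close>, \<open>b\<close> to
  \<open>a\<close>, 0, \<open>a + b\<close> and keeps their cyclic order. Most comparisons in this
  block arise from such a translation.\<close>

lemma P_sum: "0 < P (a + b)" "P (a + b) < P a"
  using cyc_add[of a 0 "- a" b] ab nonzero P_nonneg[of "a + b"] by (auto simp: cyc_def)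

lemma P_diff: "P (a + b) < P (a - b)" "P (a - b) < P a"
  using cyc_add[of a 0 b "- b"] ab nonzero P_sum by (auto simp: cyc_def)

lemma P_minus_sum: "P a \<le> P (- a + b)" "P (- a + b) < P (- a)"
proof -
  have 1: "0 < P (- a + b)" "P (- a + b) < P (- a)"
    using cyc_add[of "- a" 0 a b] ab nonzero P_nonneg[of "- a + b"] by (auto simp: cyc_def)
  then show "P (- a + b) < P (- a)" by simp
  show "P a \<le> P (- a + b)"
    using unlinkedD[OF unl(2), of 0 "- a"] 1 ab nonzero by (auto simp: linked_less_iff)
qed

lemma add_minus_conj: "b + - (- b + a + b) = - a + b"
  by (simp only: minus_add minus_minus add.assoc[symmetric] right_minus add_0_left)

lemma P_conj: "P (- b) < P (- b + a + b)" "P (- b + a + b) < P (- (- b + a + b))"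
proof -
  show 1: "P (- b) < P (- b + a + b)"
    using cyc_add[of b 0 "- b" "- b + a + b"] P_sum ab nonzero P_nonneg[of "- b + a + b"]
    by (auto simp: cyc_def add.assoc[symmetric])
  show "P (- b + a + b) < P (- (- b + a + b))"
    using cyc_add[of b 0 "- b + a + b" "- (- b + a + b)", unfolded add_minus_conj]
      P_sum P_minus_sum ab nonzero 1 P_nonneg[of "- (- b + a + b)"]
    by (auto simp: cyc_def simp flip: add.assoc)
qed

lemma P_minus_conj:
  assumes "P (- b) < P d" "unlinked a d"
  shows "P (- (- b + a + b)) < P d"
proof -
  have 1: "0 < P (b + d)" "P (b + d) < P b"
    using cyc_add[of b 0 "- b" d] ab nonzero assms P_nonneg[of "b + d"] by (auto simp: cyc_def)
  have "\<not> linked (P (- a)) (P 0) (P b) (P (b + d))"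
    using unlinkedD[OF assms(2), of "- a" b] by simp
  then have "P (- a) \<le> P (b + d)"
    using 1 ab nonzero by (subst (asm) linked_swap) (auto simp: linked_less_iff)
  then have "cyc (P b) (P (- a + b)) (P (b + d))"
    using 1 P_minus_sum by (auto simp: cyc_def)
  then show ?thesis
    using cyc_add[of b 0 "- (- b + a + b)" d, unfolded add_minus_conj] assms(1) ab nonzero
      P_nonneg[of d] P_nonneg[of "- (- b + a + b)"]
    by (auto simp: cyc_def)
qed

text \<open>Translated by \<open>b\<close>, the chord of \<open>- b + a + b\<close> joins
  \<open>b\<close> to \<open>a + b\<close>. It closes the path \<open>b\<close>, 0,
  \<open>a\<close>, \<open>a + b\<close>, which consists of translates of the chords of
  \<open>a\<close> and \<open>b\<close>; no chord of \<open>y\<close> crosses these. So a chord of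
  \<open>y\<close> could cross the closing chord only if it had an endpoint at 0 or at
  \<open>a\<close>, and \<open>gap\<close> excludes both.\<close>

lemma unlinked_conj_aux:
  assumes y: "unlinked a y" "unlinked b y"
    and gap: "\<not> (P a < P y \<and> P y < P b)" "\<not> (P a < P (- y) \<and> P (- y) < P b)"
    and p: "P (a + b) < P p" "P p < P b"
  shows "P (a + b) \<le> P (p + y)" "P (p + y) \<le> P b"
proof -
  let ?q = "p + y"
  have 1: "\<not> linked (P 0) (P b) (P p) (P ?q)" "\<not> linked (P 0) (P a) (P p) (P ?q)"
    "\<not> linked (P (a + b)) (P a) (P p) (P ?q)"
    using unlinkedD[OF y(2), of 0 p] unlinkedD[OF y(1), of 0 p] unlinkedD[OF y(2), of a p]
    by (simp_all add: linked_swap(1)[of "P (a + b)"])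
  show le: "P ?q \<le> P b" using 1(1) p nonzero P_sum P_nonneg[of p] by (auto simp: linked_less_iff)
  show "P (a + b) \<le> P ?q"
  proof (rule ccontr)
    assume "\<not> P (a + b) \<le> P ?q"
    then have q: "P ?q < P (a + b)" by simp
    then have "\<not> P p < P a" using 1(3) p P_sum by (auto simp: linked_less_iff)
    then consider "P a < P p" | "p = a" by (metis P_inject linorder_less_linear)
    then show False
    proof cases
      case 1
      with \<open>\<not> linked (P 0) (P a) (P p) (P ?q)\<close> have "P ?q = 0"
        using q P_sum P_nonneg[of ?q] by (auto simp: linked_less_iff)
      then have "?q = 0" by (metis P_0 P_inject)
      then have "p = - y" by (simp add: eq_neg_iff_add_eq_0)
      then show False using gap 1 p by simp
    next
      case 2
      then have q: "P (a + y) < P (a + b)" using q by simp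
      have "a + y \<noteq> 0"
      proof
        assume "a + y = 0"
        then have "- a = y" by (simp add: minus_unique)
        then show False using gap ab by auto
      qed
      then have "0 < P (a + y)" by (rule P_pos)
      then have "cyc (P a) (P 0) (P (a + y))" "cyc (P a) (P (a + y)) (P (a + b))"
        using q P_sum by (auto simp: cyc_def)
      then have "cyc (P 0) (P (- a)) (P y)" "cyc (P 0) (P y) (P b)"
        using cyc_add[of a 0 "- a" y] cyc_add[of a 0 y b] by simp_all
      then have "P (- a) < P y" "P y < P b" using nonzero ab P_nonneg[of y] by (auto simp: cyc_def)
      then show False using gap ab by simp
    qed
  qed
qed

lemma unlinked_conj:
  assumes "unlinked a y" "unlinked b y"
    and "\<not> (P a < P y \<and> P y < P b)" "\<not> (P a < P (- y) \<and> P (- y) < P b)"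
  shows "unlinked (- b + a + b) y"
proof (rule unlinkedI[of b])
  fix h
  have 1: "P (a + b) \<le> P (p + y)" "P (p + y) \<le> P b" if "P (a + b) < P p" "P p < P b" for p
    using unlinked_conj_aux[OF assms(1,2,3,4) that] .
  have 2: "P (a + b) \<le> P (p - y)" "P (p - y) \<le> P b" if "P (a + b) < P p" "P p < P b" for p
    using unlinked_conj_aux[of "- y" p] assms that by (simp_all add: unlinked_minus)
  have "P (a + b) < P b" using P_sum ab by simp
  then have "\<not> linked (P (a + b)) (P b) (P h) (P (h + y))"
    using 1[of h] 2[of "h + y"] by (auto simp: linked_less_iff)
  then show "\<not> linked (P b) (P (b + (- b + a + b))) (P h) (P (h + y))"
    by (simp add: linked_swap(1)[of "P b"] flip: add.assoc)
qed

text \<open>This is not a case of \<open>unlinked_conj\<close>: that would require \<open>a\<close>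
  to be unlinked with its conjugate, and \<open>gap\<close> fails for \<open>y = a\<close>, since
  \<open>- a\<close> lies between \<open>a\<close> and \<open>b\<close>. Instead the quadrilateral
  0, \<open>a + b\<close>, \<open>a\<close>, \<open>b\<close> is compared with its translate by
  \<open>h\<close>.\<close>

lemma unlinked_conj_self: "unlinked (- b + a + b) (- b + a + b)"
proof (rule unlinkedI[of b])
  fix h'
  define h where "h = h' - b"
  let ?A = "P a" and ?B = "P b" and ?C = "P (a + b)"
  let ?h = "P h" and ?hA = "P (h + a)" and ?hB = "P (h + b)" and ?hC = "P (h + a + b)"
  have cb: "unlinked (- b + a + b) b"
    using unlinked_conj[of b] unl unlinked_commute ab by simp
  have hQ: "cyc ?h ?hC ?hA" "cyc ?hC ?hA ?hB" "cyc ?hA ?hB ?h" "cyc ?hB ?h ?hC"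
    using cyc_add[of h 0 "a + b" a] cyc_add[of h "a + b" a b] cyc_add[of h a b 0] cyc_add[of h b 0 "a + b"]
      P_sum ab nonzero by (auto simp: cyc_def add.assoc)
  have aa: "\<not> linked 0 ?A ?h ?hA" using unlinkedD[OF unl(1), of 0 h] by simp
  have ba: "\<not> linked 0 ?A ?h ?hB" "\<not> linked 0 ?A ?hA ?hC"
    using unlinkedD[OF unl(2), of 0 h] unlinkedD[OF unl(2), of 0 "h + a"] by simp_all
  have bb: "\<not> linked 0 ?B ?h ?hB" "\<not> linked 0 ?B ?hA ?hC"
      "\<not> linked ?C ?A ?h ?hB" "\<not> linked ?C ?A ?hA ?hC"
    using unlinkedD[OF unl(3), of 0 h] unlinkedD[OF unl(3), of 0 "h + a"]
      unlinkedD[OF unl(3), of a h] unlinkedD[OF unl(3), of a "h + a"]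
    by (simp_all add: linked_swap(1)[of ?C])
  have bc: "\<not> linked 0 ?B ?hC ?hB" "\<not> linked ?C ?A ?hC ?hB"
    using unlinkedD[OF unlinked_commute[OF cb], of 0 "h + b"] unlinkedD[OF unlinked_commute[OF cb], of a "h + b"]
    by (simp_all add: linked_swap(2)[of _ _ ?hC] linked_swap(1)[of ?C] flip: add.assoc)
  \<comment> \<open>Unlinkedness excludes strict crossings only. When a vertex of the translated
    quadrilateral meets one of the original, the equation between group elements determines another
    vertex.\<close>
  have e1: "?hA = P (- b)" if "?hC = 0"
  proof -
    have "h + a + b = 0" using that by (metis P_0 P_inject)
    then show ?thesis by (metis add_eq_0_iff2)
  qed
  have e2: "?h = P (a - b)" if "?hB = ?A"
    using that by (auto simp: eq_diff_eq)
  have e3: "?h = P (- a)" if "?hA = 0"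
  proof -
    have "h + a = 0" using that by (metis P_0 P_inject)
    then show ?thesis by (metis add_eq_0_iff2)
  qed
  have e4: "?hA = P (a - b)" if "?hC = ?A"
    using that by (auto simp: eq_diff_eq)
  have e5: "?h = P (- b)" if "?hB = 0"
  proof -
    have "h + b = 0" using that by (metis P_0 P_inject)
    then show ?thesis by (metis add_eq_0_iff2)
  qed
  have e6: "?hB = ?C" if "?h = ?A" using that by simp
  have e7: "?hB = ?B" "?hC = ?C" if "?h = 0"
  proof -
    have "h = 0" using that by (metis P_0 P_inject)
    then show "?hB = ?B" "?hC = ?C" by simp_all
  qed
  have e8: "?h = 0" if "?hA = ?A"
  proof -
    have "h = a - a" using that by (simp only: P_inject eq_diff_eq)
    then show ?thesis by simp
  qed
  note order = P_sum P_diff ab nonzero P_nonneg[of h] P_nonneg[of "h + a"] P_nonneg[of "h + b"]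
    P_nonneg[of "h + a + b"]
  have "?C < ?B" using P_sum ab by simp
  have "\<not> linked ?C ?B ?hB ?hC"
  proof
    assume "linked ?C ?B ?hB ?hC"
    then consider "?C < ?hB" "?hB < ?B" "?hC < ?C \<or> ?B < ?hC" | "?C < ?hC" "?hC < ?B" "?hB < ?C \<or> ?B < ?hB"
      using \<open>?C < ?B\<close> by (auto simp: linked_less_iff)
    then show False
    proof cases
      case 1
      then have "?A \<le> ?hB" "?hC < ?C"
        using bc order by (auto simp: linked_less_iff linked_swap(2)[of _ _ ?hC])
      have hA: "?hC < ?hA" "?hA < ?hB" and h: "?hB < ?h \<or> ?h < ?hC"
        using hQ \<open>?hC < ?C\<close> \<open>?C < ?hB\<close> by (auto simp: cyc_def)
      show False
      proof (cases "?hB < ?h")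
        case True
        then have "?A \<le> ?hA"
          using not_linkedD(2)[OF aa] hA \<open>?A \<le> ?hB\<close> order by force
        moreover have "?hA \<noteq> ?A" using e8 True order by force
        ultimately have "\<not> 0 < ?hC" using not_linkedD(2)[OF ba(2)] \<open>?hC < ?C\<close> order by force
        then show False using e1 order hA 1 by force
      next
        case False
        then have "?h < ?hC" using h by simp
        show False
        proof (cases "?h = 0")
          case False
          then have "?hB \<le> ?A"
            using not_linkedD(1)[OF ba(1)] \<open>?h < ?hC\<close> \<open>?hC < ?C\<close> order by force
          then show False using e2 \<open>?A \<le> ?hB\<close> \<open>?h < ?hC\<close> \<open>?hC < ?C\<close> order by force
        qed (use e7 1 in force)
      qed
    next
      case 2
      then have "?A \<le> ?hC" "?hB < ?C"
        using bc order by (auto simp: linked_less_iff)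
      have h: "?hB < ?h" "?h < ?hC" and hA: "?hC < ?hA \<or> ?hA < ?hB"
        using hQ \<open>?hB < ?C\<close> \<open>?C < ?hC\<close> by (auto simp: cyc_def)
      consider "?h < ?A" | "?h = ?A" | "?A < ?h" by linarith
      then show False
      proof cases
        case h1: 1
        then have "?hA \<le> ?A"
          using not_linkedD(1)[OF aa] h order by force
        then have "?hA < ?hB" using hA \<open>?A \<le> ?hC\<close> by force
        show False
        proof (cases "?hA = 0")
          case False
          then have "?hC \<le> ?A"
            using not_linkedD(1)[OF ba(2)] \<open>?hA < ?hB\<close> \<open>?hB < ?C\<close> order by force
          then show False using e4 \<open>?A \<le> ?hC\<close> \<open>?hA < ?hB\<close> \<open>?hB < ?C\<close> order by force
        qed (use e3 order h1 in force)
      next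
        case h2: 2
        then show False using e6 \<open>?hB < ?C\<close> by simp
      next
        case h3: 3
        then have "\<not> 0 < ?hB" using not_linkedD(2)[OF ba(1)] \<open>?hB < ?C\<close> order by force
        then show False using e5 order h 2 by force
      qed
    qed
  qed
  then show "\<not> linked (P b) (P (b + (- b + a + b))) (P h') (P (h' + (- b + a + b)))"
    by (simp add: h_def linked_swap(1)[of "P b"] flip: add.assoc)
qed

end


lemma admissible_cong:
  assumes "\<And>k. k \<in> {1..n} \<Longrightarrow> g k = g' k"
  shows "admissible n g \<longleftrightarrow> admissible n g'"
  using assms by (simp add: admissible_def)

lemma admissible_step:
  assumes g: "admissible n g" and i: "1 \<le> i" "i < n"
  shows "admissible n (g(i := g (i + 1), i + 1 := - g (i + 1) + g i + g (i + 1)))" (is "admissible n ?g'")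
proof -
  define a b where "a = g i" and "b = g (i + 1)"
  have lt: "P (g k) < P (- g k)" if "k \<in> {1..n}" for k using g that by (simp add: admissible_def)
  have lt': "P (- g k) < P (g l)" if "k \<in> {1..n}" "l \<in> {1..n}" "k < l" for k l
    using g that by (simp add: admissible_def)
  have unl: "unlinked (g k) (g l)" if "k \<in> {1..n}" "l \<in> {1..n}" for k l
    using g that by (simp add: admissible_def)
  have ab: "P a < P (- a)" "P (- a) < P b" "P b < P (- b)"
    using lt[of i] lt[of "i + 1"] lt'[of i "i + 1"] i by (auto simp: a_def b_def)
  have unl_ab: "unlinked a a" "unlinked a b" "unlinked b b"
    using unl[of i i] unl[of i "i + 1"] unl[of "i + 1" "i + 1"] i by (auto simp: a_def b_def)
  define c where "c = - b + a + b"
  have c: "P (- b) < P c" "P c < P (- c)"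
    using P_conj[OF ab unl_ab] by (simp_all add: c_def)
  have cd: "P (- c) < P (g l)" if "l \<in> {1..n}" "i + 1 < l" for l
    using P_minus_conj[OF ab unl_ab, of "g l"] lt'[of "i + 1" l] unl[of i l] that i
    by (simp add: c_def a_def b_def)
  have unl_c: "unlinked c (g l)" if "l \<in> {1..n}" "l \<noteq> i" for l
    unfolding c_def
  proof (rule unlinked_conj[OF ab unl_ab])
    show "unlinked a (g l)" "unlinked b (g l)" using unl that i by (simp_all add: a_def b_def)
    have "l < i \<or> l = i + 1 \<or> i + 1 < l" using that by linarith
    then consider "l < i" | "l = i + 1" | "i + 1 < l" by blast
    then have "P (- g l) < P a \<or> P b \<le> P (g l)"
    proof cases
      case 1
      then show ?thesis using lt'[of l i] that i by (simp add: a_def)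
    next
      case 3
      then show ?thesis using lt'[of "i + 1" l] ab that i by (simp add: b_def)
    qed (simp add: b_def)
    then show "\<not> (P a < P (g l) \<and> P (g l) < P b)" "\<not> (P a < P (- g l) \<and> P (- g l) < P b)"
      using lt[OF that(1)] by auto
  qed
  have unl_cc: "unlinked c c" using unlinked_conj_self[OF ab unl_ab] by (simp add: c_def)
  \<comment> \<open>Apart from position \<open>i + 1\<close>, which holds the conjugate,
    \<open>\<pi> k\<close> is the old position of the entry now at \<open>k\<close>. It avoids
    \<open>i\<close>, the index that \<open>unl_c\<close> leaves out.\<close>
  define \<pi> where "\<pi> k = (if k = i then i + 1 else k)" for k
  have \<pi>: "?g' k = (if k = i + 1 then c else g (\<pi> k))" for k
    by (auto simp: \<pi>_def c_def a_def b_def)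
  have \<pi>_in: "\<pi> k \<in> {1..n}" "\<pi> k \<noteq> i" if "k \<in> {1..n}" for k
    using that i by (auto simp: \<pi>_def)
  show ?thesis
    unfolding admissible_def
  proof (intro conjI ballI impI)
    fix k assume k: "k \<in> {1..n}"
    show "P (?g' k) < P (- ?g' k)"
      unfolding \<pi> using c lt \<pi>_in[OF k] by simp
    fix l assume l: "l \<in> {1..n}"
    show "unlinked (?g' k) (?g' l)"
      unfolding \<pi> using unl_c unl_cc unl \<pi>_in[OF k] \<pi>_in[OF l] by (auto intro: unlinked_commute)
    assume kl: "k < l"
    consider "l < i" | "l = i" | "l = i + 1" "k < i" | "l = i + 1" "k = i"
      | "i + 1 < l" "k < i" | "i + 1 < l" "k = i" | "i + 1 < l" "k = i + 1" | "i + 1 < l" "i + 1 < k"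
      using kl by linarith
    then show "P (- ?g' k) < P (?g' l)"
    proof cases
      case 3
      then have "P (- g k) < P b" using lt'[of k "i + 1"] k i by (simp add: b_def)
      then show ?thesis using 3 c ab by (simp add: c_def a_def b_def)
    next
      case 4
      then show ?thesis using c by (simp add: c_def a_def b_def)
    next
      case 7
      then show ?thesis using cd[OF l] by (simp add: c_def a_def b_def)
    qed (use lt' k l kl i in auto)
  qed
qed

end

text \<open>The inverse generators act by the mirror image of the positive ones. Since \<open>inverse 0 = 0\<close>, the map
  \<open>inverse\<close> reverses the cyclic order on the nonnegative reals.\<close>

lemma inverse_less_iff_nonneg:
  "0 \<le> x \<Longrightarrow> 0 \<le> y \<Longrightarrow> inverse x < inverse y \<longleftrightarrow> 0 < y \<and> (x = 0 \<or> y < x)" for x y :: real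
  by (cases "x = 0"; cases "y = 0") (auto simp: inverse_less_iff_less)

lemma cyc_inverse:
  assumes "0 \<le> x" "0 \<le> y" "0 \<le> z"
  shows "cyc (inverse x) (inverse y) (inverse z) \<longleftrightarrow> cyc z y x"
  using assms unfolding cyc_def by (simp add: inverse_less_iff_nonneg) linarith

lemma linked_inverse:
  assumes "0 \<le> x" "0 \<le> y" "0 \<le> z" "0 \<le> w"
  shows "linked (inverse x) (inverse y) (inverse z) (inverse w) \<longleftrightarrow> linked x y z w"
  using linked_swap(1)[of x y z w] assms by (auto simp: linked_def cyc_inverse)

context cyclic_order
begin

lemma inverse_cyclic_order: "cyclic_order (\<lambda>a. inverse (P a))"
proof
  fix h a b c
  show "cyc (inverse (P (h + a))) (inverse (P (h + b))) (inverse (P (h + c))) \<longleftrightarrow>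
      cyc (inverse (P a)) (inverse (P b)) (inverse (P c))"
    by (simp add: cyc_inverse P_nonneg cyc_add)
qed (auto simp: P_pos)

interpretation inv: cyclic_order "\<lambda>a. inverse (P a)"
  by (rule inverse_cyclic_order)

lemma unlinked_inverse: "inv.unlinked a b \<longleftrightarrow> unlinked a b"
  using linked_inverse[of 0] by (simp add: inv.unlinked_def unlinked_def P_nonneg)

text \<open>Reflecting the disc reverses the order of the punctures and the orientation of the
  loops; hence the index \<open>n + 1 - k\<close> and the minus sign.\<close>

lemma admissible_inverse:
  assumes "admissible n g"
  shows "inv.admissible n (\<lambda>k. - g (n + 1 - k))"
proof -
  have 1: "unlinked (- g k) (- g l)" if "k \<in> {1..n}" "l \<in> {1..n}" for k l
    using assms that by (metis admissible_def unlinked_commute unlinked_minus)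
  have 2: "inverse (P a) < inverse (P b)" if "P b < P a" "b \<noteq> 0" for a b
    using that P_pos[of b] by (simp add: inverse_less_iff_nonneg P_nonneg)
  have 3: "g k \<noteq> 0" if "k \<in> {1..n}" for k
    using assms that unfolding admissible_def by (metis minus_zero less_irrefl)
  show ?thesis
    unfolding inv.admissible_def unlinked_inverse
  proof (intro conjI ballI impI)
    fix k assume k: "k \<in> {1..n}"
    then have k': "n + 1 - k \<in> {1..n}" by auto
    then show "inverse (P (- g (n + 1 - k))) < inverse (P (- (- g (n + 1 - k))))"
      using assms by (intro 2) (auto simp: admissible_def 3)
    fix l assume l: "l \<in> {1..n}"
    then have l': "n + 1 - l \<in> {1..n}" by auto
    with k' show "unlinked (- g (n + 1 - k)) (- g (n + 1 - l))" by (rule 1)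
    assume "k < l"
    with k l have "P (- g (n + 1 - l)) < P (g (n + 1 - k))"
      using assms k' l' by (auto simp: admissible_def)
    then show "inverse (P (- (- g (n + 1 - k)))) < inverse (P (- g (n + 1 - l)))"
      using 3[OF l'] by (intro 2) auto
  qed
qed

end

text \<open>In the mirror image the entries at \<open>i\<close> and \<open>i + 1\<close> stand at
  \<open>n - i + 1\<close> and \<open>n - i\<close>, and the inverse move at \<open>i\<close>
  becomes the positive move at \<open>n - i\<close>.\<close>

lemma (in cyclic_order) admissible_step_inverse:
  assumes g: "admissible n g" and i: "1 \<le> i" "i < n"
  shows "admissible n (g(i := g i + g (i + 1) - g i, i + 1 := g i))" (is "admissible n ?g'")
proof -
  interpret inv: cyclic_order "\<lambda>a. inverse (P a)"
    by (rule inverse_cyclic_order)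
  define h where "h k = - g (n + 1 - k)" for k
  define h' where "h' = h(n - i := h (n - i + 1), n - i + 1 := - h (n - i + 1) + h (n - i) + h (n - i + 1))"
  have "inv.admissible n h" using admissible_inverse[OF g] by (simp add: h_def[abs_def])
  then have "inv.admissible n h'" using inv.admissible_step[of n h "n - i"] i by (simp add: h'_def)
  from inv.admissible_inverse[OF this]
  have "admissible n (\<lambda>k. - h' (n + 1 - k))" by simp
  moreover have "- h' (n + 1 - k) = ?g' k" if "k \<in> {1..n}" for k
  proof -
    consider "k = i" | "k = i + 1" | "k \<noteq> i" "k \<noteq> i + 1" by blast
    then show ?thesis
    proof cases
      case 1
      then have "n + 1 - k = n - i + 1" using i by simp
      then show ?thesis using 1 i by (simp add: h'_def h_def Suc_diff_le diff_diff_eq2)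
    next
      case 2
      then have "n + 1 - k = n - i" "n - i \<noteq> n - i + 1" using i by simp_all
      then show ?thesis using 2 i by (simp add: h'_def h_def Suc_diff_le)
    next
      case 3
      then have "n + 1 - k \<noteq> n - i" "n + 1 - k \<noteq> n - i + 1" "n + 1 - (n + 1 - k) = k"
        using i that by auto
      then show ?thesis using 3 by (simp add: h'_def h_def)
    qed
  qed
  ultimately show ?thesis using admissible_cong[of n "\<lambda>k. - h' (n + 1 - k)" ?g'] by blast
qed

section \<open>A cyclic order on the free group\<close>

text \<open>Sectors have width 1, so spacing 3 keeps the sectors of other generators at distance
  more than 1 from a centre. The offset 3 does the same for the point 0 and makes all sectors
  positive.\<close>

definition centre :: "nat \<times> bool \<Rightarrow> real"
  where "centre p = 3 * real (fst p) + 3"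

text \<open>With absolute value 2, the pole of \<open>moebius p\<close> is the midpoint of the
  sector of the inverse letter, and the far end of that sector goes to the far end of
  \<open>sector p\<close>. So all points outside the closed sector of the inverse letter are mapped
  into \<open>sector p\<close>.\<close>

definition coefficient :: "nat \<times> bool \<Rightarrow> real"
  where "coefficient p = (if snd p then - 2 else 2)"

text \<open>Letters act on the projective line as parabolic maps, with a letter and its inverse playing ping-pong between
  the two sides of their fixed point \<open>centre p\<close>; the sectors of different letters are disjoint, and \<open>0\<close> is in none.
  Division by zero is harmless: no point of the orbit of \<open>0\<close> is a pole.\<close>

definition moebius :: "nat \<times> bool \<Rightarrow> real \<Rightarrow> real"
  where "moebius p z = centre p + (z - centre p) / (1 + coefficient p * (z - centre p))"

definition sector :: "nat \<times> bool \<Rightarrow> real set"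
  where "sector p = (if snd p then {centre p - 1<..<centre p} else {centre p<..<centre p + 1})"

definition point :: "fgrp \<Rightarrow> real"
  where "point a = foldr moebius (rep a) 0"

text \<open>The directions at a vertex of the planar Cayley tree, numbered in cyclic order: \<open>0\<close> is the base point,
  \<open>2 k + 1\<close> and \<open>2 k + 2\<close> are the two sides of the ray of puncture \<open>k\<close>, through which \<open>x\<^sub>k\<close> and its inverse enter.\<close>

fun enter :: "nat \<times> bool \<Rightarrow> nat"
  where "enter (k, b) = 2 * k + (if b then 1 else 2)"

definition vertex :: "fgrp \<Rightarrow> nat"
  where "vertex a = (case rep a of [] \<Rightarrow> 0 | p # w \<Rightarrow> enter p)"

lemma enter_pos [simp]: "0 < enter p"
  by (cases p) simp

lemma enter_inject [simp]: "enter p = enter q \<longleftrightarrow> p = q"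
proof -
  obtain j b k c where "p = (j, b)" "q = (k, c)" by (metis surj_pair)
  moreover have "2 * j + 1 \<noteq> 2 * k + 2" "2 * j + 2 \<noteq> 2 * k + 1" by presburger+
  ultimately show ?thesis by auto
qed

lemma centre_flip [simp]: "centre (flip p) = centre p"
  by (simp add: centre_def)

lemma coefficient_flip [simp]: "coefficient (flip p) = - coefficient p"
  by (cases p) (simp add: coefficient_def)

lemma sector_less:
  assumes "y \<in> sector p" "z \<in> sector q" "enter p < enter q"
  shows "y < z"
proof -
  obtain j b k c where [simp]: "p = (j, b)" "q = (k, c)" by (metis surj_pair)
  have "j < k \<or> j = k \<and> b \<and> \<not> c" using assms(3) by (cases b; cases c) auto
  then consider "j < k" | "j = k" "b" "\<not> c" by blast
  then show ?thesis
  proof cases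
    case 1
    then have "real j + 1 \<le> real k" by simp
    then show ?thesis using assms(1,2) by (auto simp: sector_def centre_def split: if_splits)
  qed (use assms in \<open>auto simp: sector_def centre_def\<close>)
qed

lemma sector_pos: "z \<in> sector p \<Longrightarrow> 0 < z"
  by (auto simp: sector_def centre_def split: if_splits)

lemma sector_gap:
  assumes "z \<in> sector q" "fst q \<noteq> fst p"
  shows "z < centre p - 1 \<or> centre p + 1 < z"
proof -
  consider "real (fst q) + 1 \<le> real (fst p)" | "real (fst p) + 1 \<le> real (fst q)" using assms(2) by linarith
  then show ?thesis using assms(1) by cases (auto simp: sector_def centre_def split: if_splits)
qed

lemma moebius_sector:
  assumes "z = 0 \<or> z \<in> sector q \<and> q \<noteq> flip p"
  shows "moebius p z \<in> sector p" "1 + coefficient p * (z - centre p) \<noteq> 0"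
proof -
  define y where "y = z - centre p"
  obtain k b where p: "p = (k, b)" by (cases p)
  have "y < - 1 \<or> 1 < y \<or> y \<in> (if b then {- 1<..<0} else {0<..<1})"
  proof (cases "z = 0 \<or> fst q \<noteq> k")
    case True
    then show ?thesis using assms sector_gap[of z q p] by (auto simp: y_def p centre_def)
  next
    case False
    then have "q = p" using assms p by (cases q) auto
    then show ?thesis using False assms p by (auto simp: y_def sector_def)
  qed
  then have "1 + coefficient p * y \<noteq> 0 \<and> y / (1 + coefficient p * y) \<in> (if b then {- 1<..<0} else {0<..<1})"
    by (cases b) (auto simp: coefficient_def p divide_simps)
  moreover have "moebius p z = centre p + y / (1 + coefficient p * y)" by (simp add: moebius_def y_def)
  ultimately have "1 + coefficient p * y \<noteq> 0 \<and> moebius p z \<in> sector p"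
    by (cases b) (auto simp: sector_def p)
  then show "moebius p z \<in> sector p" "1 + coefficient p * (z - centre p) \<noteq> 0"
    by (simp_all add: y_def)
qed

lemma foldr_moebius_sector: "reduced (p # w) \<Longrightarrow> foldr moebius (p # w) 0 \<in> sector p"
proof (induction w arbitrary: p)
  case (Cons q w)
  then show ?case using moebius_sector(1)[of "foldr moebius (q # w) 0" q p] by simp
qed (simp add: moebius_sector)

lemma point_sector: "rep a = p # w \<Longrightarrow> point a \<in> sector p"
  unfolding point_def using foldr_moebius_sector reduced_rep by metis

lemma vertex_0 [simp]: "vertex 0 = 0"
  by (simp add: vertex_def)

lemma vertex_eq_0 [simp]: "vertex a = 0 \<longleftrightarrow> a = 0"
  by (auto simp: vertex_def split: list.splits)

lemma vertex_pos [simp]: "0 < vertex a \<longleftrightarrow> a \<noteq> 0"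
  by (simp flip: neq0_conv)

lemma vertex_Cons: "rep a = p # w \<Longrightarrow> vertex a = enter p"
  by (simp add: vertex_def)

lemma point_0 [simp]: "point 0 = 0"
  by (simp add: point_def)

lemma point_less: "vertex a < vertex b \<Longrightarrow> point a < point b"
proof -
  assume *: "vertex a < vertex b"
  then obtain q w where b: "rep b = q # w" by (auto simp: vertex_def split: list.splits)
  show ?thesis
  proof (cases "rep a")
    case Nil
    then show ?thesis using sector_pos[OF point_sector[OF b]] by simp
  next
    case (Cons p v)
    then show ?thesis using * b point_sector sector_less by (metis vertex_Cons)
  qed
qed

text \<open>If the new letter cancels the first letter of \<open>a\<close>, the claim is that
  \<open>moebius p\<close> undoes \<open>moebius (flip p)\<close>. The denominators of the two maps
  are reciprocal, which also shows that they do not vanish.\<close>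

lemma point_letter:
  shows "point (of_word [p] + a) = moebius p (point a)"
    and "1 + coefficient p * (point a - centre p) \<noteq> 0"
proof -
  have rep: "rep (of_word [p] + a) = push p (rep a)"
    using red_simps(2)[of p "rep a"] by (simp add: rep_add)
  have "point (of_word [p] + a) = moebius p (point a) \<and> 1 + coefficient p * (point a - centre p) \<noteq> 0"
  proof (cases "rep a = [] \<or> hd (rep a) \<noteq> flip p")
    case True
    then have "push p (rep a) = p # rep a" by (cases "rep a") auto
    moreover have "point a = 0 \<or> point a \<in> sector (hd (rep a)) \<and> hd (rep a) \<noteq> flip p"
      using True point_sector[of a "hd (rep a)" "tl (rep a)"] by (cases "rep a = []") (auto simp: point_def)
    ultimately show ?thesis using moebius_sector(2) rep by (auto simp: point_def)
  next
    case False
    then obtain w where w: "rep a = flip p # w" by (cases "rep a") auto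
    define z where "z = foldr moebius w 0"
    have "z = 0 \<or> z \<in> sector (hd w) \<and> hd w \<noteq> flip (flip p)"
      using reduced_rep[of a] foldr_moebius_sector[of "hd w" "tl w"]
      by (cases w) (auto simp: z_def w)
    from moebius_sector(2)[OF this]
    have D: "1 - coefficient p * (z - centre p) \<noteq> 0" by simp
    have a: "point a - centre p = (z - centre p) / (1 - coefficient p * (z - centre p))"
      using w by (simp add: point_def moebius_def z_def)
    have 1: "1 + coefficient p * (point a - centre p) = 1 / (1 - coefficient p * (z - centre p))"
      unfolding a times_divide_eq_right using D by (simp only: divide_simps) simp
    then have "moebius p (point a) = z" unfolding moebius_def 1 unfolding a using D by simp
    moreover have "point (of_word [p] + a) = z" using rep w by (simp add: point_def z_def)
    ultimately show ?thesis using 1 D by simp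
  qed
  then show "point (of_word [p] + a) = moebius p (point a)" "1 + coefficient p * (point a - centre p) \<noteq> 0"
    by simp_all
qed

text \<open>In this form invariance under \<open>moebius\<close> is visible: each difference is
  divided by the denominators of its two points, so every denominator occurs squared in the
  product.\<close>

lemma cyc_iff: "cyc x y z \<longleftrightarrow> (y - x) * (z - y) * (x - z) < 0"
  by (auto simp: cyc_def mult_less_0_iff zero_less_mult_iff)

lemma moebius_diff:
  assumes "1 + coefficient p * (y - centre p) \<noteq> 0" "1 + coefficient p * (z - centre p) \<noteq> 0"
  shows "moebius p y - moebius p z =
    (y - z) / ((1 + coefficient p * (y - centre p)) * (1 + coefficient p * (z - centre p)))"
proof -
  define y' z' where "y' = y - centre p" and "z' = z - centre p"
  have "y' / (1 + coefficient p * y') - z' / (1 + coefficient p * z') =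
      (y' - z') / ((1 + coefficient p * y') * (1 + coefficient p * z'))"
    using assms by (simp add: y'_def[symmetric] z'_def[symmetric] divide_simps) (simp add: algebra_simps)
  then show ?thesis by (simp add: moebius_def y'_def z'_def)
qed

lemma cyc_moebius:
  assumes "1 + coefficient p * (x - centre p) \<noteq> 0" "1 + coefficient p * (y - centre p) \<noteq> 0"
    "1 + coefficient p * (z - centre p) \<noteq> 0"
  shows "cyc (moebius p x) (moebius p y) (moebius p z) \<longleftrightarrow> cyc x y z"
proof -
  define a b c where "a = 1 + coefficient p * (x - centre p)" and "b = 1 + coefficient p * (y - centre p)"
    and "c = 1 + coefficient p * (z - centre p)"
  have "(moebius p y - moebius p x) * (moebius p z - moebius p y) * (moebius p x - moebius p z) =
      ((y - x) * (z - y) * (x - z)) / (a * b * c)\<^sup>2"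
    using assms by (simp add: moebius_diff a_def[symmetric] b_def[symmetric] c_def[symmetric] power2_eq_square)
  moreover have "0 < (a * b * c)\<^sup>2" using assms by (simp add: a_def b_def c_def)
  ultimately show ?thesis by (simp add: cyc_iff divide_less_0_iff)
qed

lemma point_pos: "a \<noteq> 0 \<Longrightarrow> 0 < point a"
  using point_less[of 0 a] by simp

lemma cyc_point: "cyc (point (h + a)) (point (h + b)) (point (h + c)) \<longleftrightarrow> cyc (point a) (point b) (point c)"
  by (induction h rule: fgrp_induct) (simp_all add: add.assoc point_letter cyc_moebius)

lemma moebius_inject:
  assumes "1 + coefficient p * (y - centre p) \<noteq> 0" "1 + coefficient p * (z - centre p) \<noteq> 0"
  shows "moebius p y = moebius p z \<longleftrightarrow> y = z"
  using moebius_diff[OF assms] assms by auto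

lemma point_add_eq: "point (h + a) = point (h + b) \<longleftrightarrow> point a = point b"
  by (induction h rule: fgrp_induct) (simp_all add: add.assoc point_letter moebius_inject)

lemma point_inject: "point a = point b \<longleftrightarrow> a = b"
proof
  assume "point a = point b"
  then have "point (- b + a) = 0" using point_add_eq[of "- b" a b] by simp
  then have "- b + a = 0" using point_pos[of "- b + a"] by (cases "- b + a = 0") auto
  then show "a = b" by (metis add_minus_cancel add_0_right)
qed simp

interpretation point: cyclic_order point
  by standard (simp_all add: point_pos point_inject cyc_point)

section \<open>The generators form an admissible tuple\<close>

lemma not_linked_left [simp]: "\<not> linked x y x w" "\<not> linked x y z x" "\<not> linked x y y w" "\<not> linked x y z y"
  by (auto simp: linked_def cyc_def)

lemma vertex_add_gen:
  assumes "h \<noteq> 0" "h + gen l \<noteq> 0"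
  shows "vertex (h + gen l) = vertex h"
proof (cases "reduced (rep h @ [(l, True)])")
  case True
  then show ?thesis using assms by (simp add: vertex_def rep_add red_reduced) (cases "rep h"; simp)
next
  case False
  then have "rep h \<noteq> []" "last (rep h) = (l, False)"
    using assms by (cases "last (rep h)"; auto simp: reduced_append)+
  then obtain w where w: "rep h = w @ [(l, False)]" by (metis append_butlast_last_id)
  then have "rep (h + gen l) = w"
    using red_cancel[of w "(l, False)" "[]"] reduced_rep[of h] by (simp add: rep_add red_reduced reduced_append)
  then show ?thesis using w assms by (cases w) (auto simp: vertex_def)
qed

lemma not_linked_vertex:
  assumes "vertex b = vertex c" "vertex a \<noteq> vertex b" "b \<noteq> 0"
  shows "\<not> linked 0 (point a) (point b) (point c)"
proof -
  have "0 < point b" "0 < point c" using assms point_less[of 0 b] point_less[of 0 c] vertex_eq_0 by fastforce+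
  moreover have "(point a < point b \<and> point a < point c) \<or> (point b < point a \<and> point c < point a)"
    using assms point_less[of a b] point_less[of a c] point_less[of b a] point_less[of c a] by linarith
  ultimately show ?thesis by (auto simp: linked_def cyc_def)
qed

text \<open>Unless \<open>h\<close> begins with the letter of \<open>gen k\<close>, both ends of the
  translated chord lie in one sector that does not contain \<open>point (gen k)\<close>. If it does,
  translation by \<open>- gen k\<close> makes the fixed chord run from \<open>- gen k\<close> to 0,
  and the rest of \<open>h\<close> cannot begin with the inverse letter.\<close>

lemma unlinked_gen: "point.unlinked (gen k) (gen l)"
  unfolding point.unlinked_def
proof
  fix h
  show "\<not> linked (point 0) (point (gen k)) (point h) (point (h + gen l))"
  proof (cases "h = 0 \<or> h + gen l = 0")
    case False
    show ?thesis
    proof (cases "vertex (gen k) = vertex h")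
      case True
      then obtain w where w: "rep h = (k, True) # w"
        using False by (cases "rep h") (auto simp: vertex_def simp del: enter.simps)
      define h' where "h' = of_word w"
      have "reduced ((k, True) # w)" using w reduced_rep by metis
      then have red: "reduced w" by (simp add: reduced_Cons)
      have h: "h = gen k + h'" using of_wordD[OF w] by (simp add: h'_def of_word_Cons[of _ w] gen_def)
      have "\<not> linked 0 (point (- gen k)) (point h') (point (h' + gen l))"
      proof (cases "h' = 0 \<or> h' + gen l = 0")
        case False
        moreover have "vertex h' \<noteq> vertex (- gen k)"
        proof -
          have "rep h' = w" by (simp add: h'_def red_reduced red)
          moreover from this obtain q v where "w = q # v" using False by (cases w) auto
          moreover have "q \<noteq> (k, False)" using \<open>reduced ((k, True) # w)\<close> \<open>w = q # v\<close> by simp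
          ultimately have "vertex h' = enter q" "q \<noteq> (k, False)" by (simp_all add: vertex_Cons)
          moreover have "vertex (- gen k) = enter (k, False)" by (simp add: vertex_def)
          ultimately show ?thesis by (simp del: enter.simps)
        qed
        ultimately show ?thesis using not_linked_vertex[of h' "h' + gen l"] vertex_add_gen by auto
      qed (auto simp: linked_commute)
      then have "\<not> linked (point (- gen k)) (point 0) (point h') (point (h' + gen l))"
        by (simp add: linked_swap(1))
      then show ?thesis
        using point.linked_add[of "gen k" "- gen k" 0 h' "h' + gen l"] by (simp add: h add.assoc)
    qed (use False not_linked_vertex[of h "h + gen l" "gen k"] vertex_add_gen in auto)
  qed auto
qed

lemma admissible_gen: "point.admissible n gen"
  using unlinked_gen by (auto simp: point.admissible_def vertex_def intro!: point_less)

section \<open>Conjugates of generators\<close>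

definition conjugate :: "bool \<Rightarrow> 'a::group_add \<Rightarrow> 'a \<Rightarrow> 'a"
  where "conjugate e b a = (if e then - b + a + b else b + a - b)"

lemma conjugate_cancel [simp]: "conjugate (\<not> e) b (conjugate e b a) = a"
  by (cases e) (simp_all add: conjugate_def add.assoc diff_conv_add_uminus minus_add del: add_uminus_conv_diff)

lemma conjugate_conjugate:
  "conjugate e' (conjugate e a c) (conjugate e a b) = conjugate e a (conjugate e' c b)"
  by (cases e; cases e') (simp_all add: conjugate_def add.assoc diff_conv_add_uminus minus_add
      del: add_uminus_conv_diff)

abbreviation norm_len :: "fgrp \<Rightarrow> nat"
  where "norm_len a \<equiv> length (rep a)"

abbreviation conj_word :: "nat word \<Rightarrow> nat \<Rightarrow> nat word"
  where "conj_word v k \<equiv> v @ (k, True) # winv v"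

lemma of_conj_word: "of_word (conj_word v k) = of_word v + gen k - of_word v"
  by (simp add: of_word_append of_word_Cons[of _ "winv v"] of_word_winv gen_def add.assoc
      diff_conv_add_uminus del: add_uminus_conv_diff)

lemma reduced_conj_word:
  "reduced (conj_word v k) \<longleftrightarrow> reduced v \<and> (v = [] \<or> fst (last v) \<noteq> k)"
proof -
  have "hd (winv v) = flip (last v)" if "v \<noteq> []"
    using that by (cases v rule: rev_cases) simp_all
  then show ?thesis by (cases "last v") (auto simp: reduced_append reduced_Cons)
qed

lemma conj_word_inject: "conj_word u j = conj_word v k \<longleftrightarrow> u = v \<and> j = k"
proof
  assume *: "conj_word u j = conj_word v k"
  from arg_cong[OF this, of length] have "length u = length v" by simp
  with * show "u = v \<and> j = k" by simp
qed simp

text \<open>Powers of \<open>gen j\<close> at the end of the conjugator commute with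
  \<open>gen j\<close>. Dropping them leaves the reduced word of the conjugate.\<close>

lemma conj_word_strip:
  assumes "reduced w"
  obtains v m e where "w = v @ replicate m (j, e)" "reduced (conj_word v j)"
    "of_word w + gen j - of_word w = of_word (conj_word v j)"
proof -
  have "\<exists>v m e. w = v @ replicate m (j, e) \<and> reduced (conj_word v j) \<and>
      of_word w + gen j - of_word w = of_word (conj_word v j)"
    using assms
  proof (induction w rule: rev_induct)
    case (snoc q w)
    then have w: "reduced w" by (simp add: reduced_append)
    show ?case
    proof (cases "fst q = j")
      case False
      then have "reduced (conj_word (w @ [q]) j)" using snoc.prems by (simp only: reduced_conj_word) simp
      then show ?thesis
        by (intro exI[of _ "w @ [q]"] exI[of _ 0] exI[of _ True]) (simp only: of_conj_word, simp)
    next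
      case True
      then obtain e where q: "q = (j, e)" by (cases q) auto
      obtain v m e' where v: "w = v @ replicate m (j, e')" "reduced (conj_word v j)"
          "of_word w + gen j - of_word w = of_word (conj_word v j)"
        using snoc.IH[OF w] by blast
      have "m = 0 \<or> e' = e"
      proof (cases m)
        case (Suc m')
        then have "w = (v @ replicate m' (j, e')) @ [(j, e')]" using v(1) by (simp add: replicate_append_same)
        then show ?thesis using snoc.prems q by (auto simp: reduced_append)
      qed simp
      then have "w @ [q] = v @ replicate (Suc m) (j, e)"
        using v(1) q by (auto simp: replicate_append_same)
      moreover have "of_word (w @ [q]) + gen j - of_word (w @ [q]) = of_word w + gen j - of_word w"
        by (cases e) (simp_all add: of_word_append of_word_letter q add.assoc diff_conv_add_uminus minus_add
            del: add_uminus_conv_diff)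
      ultimately show ?thesis using v by metis
    qed
  qed (auto simp: gen_def)
  then show ?thesis using that by blast
qed

definition is_conj :: "fgrp \<Rightarrow> bool"
  where "is_conj a \<longleftrightarrow> (\<exists>v k. rep a = conj_word v k)"

lemma is_conjI: "is_conj (u + gen k - u)"
proof -
  obtain v m e where "reduced (conj_word v k)" "of_word (rep u) + gen k - of_word (rep u) = of_word (conj_word v k)"
    using conj_word_strip[OF reduced_rep[of u], of k] by metis
  then show ?thesis by (auto simp: is_conj_def red_reduced)
qed

lemma is_conjE:
  assumes "is_conj a"
  obtains v k where "rep a = conj_word v k" "a = of_word v + gen k - of_word v"
  using assms of_wordD of_conj_word unfolding is_conj_def by metis

lemma is_conj_gen [simp]: "is_conj (gen k)"
  using is_conjI[of 0] by simp

lemma conjugate_eq: "conjugate e b (u + x - u) = ((if e then - b else b) + u) + x - ((if e then - b else b) + u)"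
  by (cases e) (simp_all add: conjugate_def add.assoc diff_conv_add_uminus minus_add del: add_uminus_conv_diff)

lemma is_conj_conjugate: "is_conj a \<Longrightarrow> is_conj (conjugate e b a)"
  by (elim is_conjE) (simp add: conjugate_eq is_conjI)

lemma norm_len_conj: "norm_len (of_word w + gen k - of_word w) \<le> 2 * length w + 1"
  using length_red[of "conj_word w k"] by (simp flip: of_conj_word)

text \<open>Geometrically: in the Cayley tree, \<open>a = u x u\<^sup>-\<^sup>1\<close> marks the edge \<open>(u, u x)\<close>, and \<open>dominates e b a\<close>
  says that the edge of \<open>a\<close> lies beyond the edge of \<open>b\<close>, where \<open>e\<close> records on which side it is passed.\<close>

definition dominates :: "bool \<Rightarrow> fgrp \<Rightarrow> fgrp \<Rightarrow> bool"
  where "dominates e b a \<longleftrightarrow>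
    (\<exists>v k r j. rep b = conj_word v k \<and> rep a = conj_word (v @ (k, e) # r) j)"

text \<open>Conjugation by \<open>b\<close> deletes the letter \<open>(k, e)\<close> that follows
  the prefix \<open>v\<close>. Every shortening move is a deletion of this kind.\<close>

lemma conjugate_word:
  assumes "b = of_word v + gen k - of_word v"
  shows "conjugate e b (of_word (v @ (k, e) # r) + x - of_word (v @ (k, e) # r)) =
    of_word (v @ r) + x - of_word (v @ r)"
  unfolding conjugate_eq
  by (cases e) (simp_all add: assms of_word_append of_word_Cons[of _ r] of_word_letter add.assoc
      diff_conv_add_uminus minus_add del: add_uminus_conv_diff)

lemma dominates_length:
  assumes "dominates e b a"
  shows "norm_len (conjugate e b a) < norm_len a"
proof -
  obtain v k r j where b: "rep b = conj_word v k" and a: "rep a = conj_word (v @ (k, e) # r) j"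
    using assms by (auto simp: dominates_def)
  have "norm_len (conjugate e b a) \<le> 2 * length (v @ r) + 1"
    using norm_len_conj[of "v @ r" j] conjugate_word[of b v k e r "gen j"] of_wordD[OF b] of_wordD[OF a]
    by (simp only: of_conj_word)
  then show ?thesis by (simp add: a)
qed

text \<open>The two conjugations delete two different letters of the conjugator of \<open>a\<close>,
  the second one nearer to its beginning.\<close>

lemma dominates_trans_length:
  assumes "dominates e b a" "dominates e' c b"
  shows "dominates e' c a" "norm_len (conjugate e' c (conjugate e b a)) < norm_len a"
proof -
  obtain v k r j where b: "rep b = conj_word v k" and a: "rep a = conj_word (v @ (k, e) # r) j"
    using assms by (auto simp: dominates_def)
  obtain w l s where c: "rep c = conj_word w l" and v: "v = w @ (l, e') # s"
    using assms b conj_word_inject unfolding dominates_def by metis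
  show "dominates e' c a"
    unfolding dominates_def
    by (intro exI[of _ w] exI[of _ l] exI[of _ "s @ (k, e) # r"] exI[of _ j]) (simp add: a c v)
  have "conjugate e b a = of_word (v @ r) + gen j - of_word (v @ r)"
    using conjugate_word[of b v k e r "gen j"] of_wordD[OF b] of_wordD[OF a] by (simp only: of_conj_word)
  then have "conjugate e' c (conjugate e b a) = of_word (w @ s @ r) + gen j - of_word (w @ s @ r)"
    using conjugate_word[of c w l e' "s @ r" "gen j"] of_wordD[OF c] by (simp only: of_conj_word v append.assoc append_Cons)
  then have "norm_len (conjugate e' c (conjugate e b a)) \<le> 2 * length (w @ s @ r) + 1"
    using norm_len_conj[of "w @ s @ r" j] by simp
  then show "norm_len (conjugate e' c (conjugate e b a)) < norm_len a" by (simp add: a v)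
qed

lemma dominates_longer: "dominates e b a \<Longrightarrow> norm_len b < norm_len a"
  by (auto simp: dominates_def)

text \<open>The conjugators of \<open>a\<close> and \<open>c\<close>, each extended by its marked
  letter, are prefixes of the conjugator of \<open>b\<close>, hence comparable; the signs of the
  marked letters prevent them from coinciding.\<close>

lemma dominates_comparable:
  assumes "dominates False a b" "dominates True c b"
  shows "dominates False a c \<or> dominates True c a"
proof -
  obtain u j r k where a: "rep a = conj_word u j" and b: "rep b = conj_word (u @ (j, False) # r) k"
    using assms by (auto simp: dominates_def)
  obtain w l s where c: "rep c = conj_word w l" and eq: "u @ (j, False) # r = w @ (l, True) # s"
    using assms b conj_word_inject unfolding dominates_def by metis
  from eq consider t where "u = w @ t" "t @ (j, False) # r = (l, True) # s"
    | t where "w = u @ t" "(j, False) # r = t @ (l, True) # s"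
    by (auto simp: append_eq_append_conv2)
  then show ?thesis
  proof cases
    case 1
    then obtain t' where "u = w @ (l, True) # t'" by (cases t) auto
    then have "dominates True c a" unfolding dominates_def using a c by blast
    then show ?thesis ..
  next
    case 2
    then obtain t' where "w = u @ (j, False) # t'" by (cases t) auto
    then have "dominates False a c" unfolding dominates_def using a c by blast
    then show ?thesis ..
  qed
qed

text \<open>Where conjugation by \<open>b\<close> finds no letter \<open>(k, e)\<close> to delete,
  it inserts the opposite one. Stripping the end of the conjugator could remove that letter only if
  the conjugate were \<open>b\<close> itself, and then \<open>a = b\<close>.\<close>

lemma dominates_conjugate:
  assumes "is_conj a" "is_conj b" "a \<noteq> b" "\<not> dominates e b a"
  shows "dominates (\<not> e) b (conjugate e b a)"
proof -
  obtain u j where a: "rep a = conj_word u j" "a = of_word u + gen j - of_word u"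
    using assms(1) by (rule is_conjE)
  obtain v k where b: "rep b = conj_word v k" "b = of_word v + gen k - of_word v"
    using assms(2) by (rule is_conjE)
  have red_u: "reduced u" and red_v: "reduced v" "v = [] \<or> fst (last v) \<noteq> k"
    using reduced_rep[of a] reduced_rep[of b] unfolding a(1) b(1) reduced_conj_word by blast+
  have red_vk: "reduced (v @ (k, e') # z)" if "reduced ((k, e') # z)" for e' z
    using red_v that by (auto simp: reduced_append) (metis fst_conv fst_flip)
  define z where "z = red (winv v @ u)"
  have z: "of_word u = of_word v + of_word z"
    by (simp add: z_def of_word_append of_word_winv flip: add.assoc)
  have "z = [] \<or> hd z \<noteq> (k, e)"
  proof (rule ccontr)
    assume "\<not> ?thesis"
    then obtain r where r: "z = (k, e) # r" by (cases z) auto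
    have "reduced z" by (simp add: z_def)
    then have "reduced (v @ (k, e) # r)" using red_vk r by blast
    moreover have "of_word u = of_word (v @ (k, e) # r)" using z r by (simp add: of_word_append)
    ultimately have "u = v @ (k, e) # r" using red_u by (simp add: of_word_eq_iff red_reduced)
    then show False using assms(4) a b by (auto simp: dominates_def)
  qed
  then have w: "reduced (v @ (k, \<not> e) # z)"
    by (intro red_vk) (auto simp: reduced_Cons z_def)
  define w where "w = v @ (k, \<not> e) # z"
  have "(if e then - b else b) + of_word u = of_word w"
    by (cases e) (simp_all add: w_def b(2) z of_word_append of_word_Cons[of _ z] of_word_letter add.assoc
      diff_conv_add_uminus minus_add del: add_uminus_conv_diff)
  then have a': "conjugate e b a = of_word w + gen j - of_word w"
    by (simp only: a(2) conjugate_eq)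
  obtain v' m e' where v': "w = v' @ replicate m (j, e')" "reduced (conj_word v' j)"
      "of_word w + gen j - of_word w = of_word (conj_word v' j)"
    using conj_word_strip[of w j] w w_def by blast
  have rep: "rep (conjugate e b a) = conj_word v' j" by (simp only: a' v'(3) rep_of_word red_reduced[OF v'(2)])
  from v'(1) obtain t where "v = v' @ t \<and> t @ (k, \<not> e) # z = replicate m (j, e') \<or>
      v' = v @ t \<and> (k, \<not> e) # z = t @ replicate m (j, e')"
    unfolding w_def append_eq_append_conv2 by blast
  then consider "v' = v @ t" "t \<noteq> []" "(k, \<not> e) # z = t @ replicate m (j, e')"
    | "v = v' @ t" "t @ (k, \<not> e) # z = replicate m (j, e')"
    by (cases "t = []") auto
  then show ?thesis
  proof cases
    case 1
    then obtain r where "v' = v @ (k, \<not> e) # r" by (cases t) auto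
    then show ?thesis using b(1) rep by (auto simp: dominates_def)
  next
    case 2
    have "set (t @ (k, \<not> e) # z) \<subseteq> {(j, e')}" unfolding 2(2) by auto
    then have k: "(k, \<not> e) = (j, e')" "set t \<subseteq> {(j, e')}" by auto
    have "t = []"
    proof (rule ccontr)
      assume "t \<noteq> []"
      then have "last t = (j, e')" using k(2) last_in_set by blast
      then have "last v = (j, e')" using 2(1) \<open>t \<noteq> []\<close> by simp
      then show False using red_v(2) k(1) \<open>t \<noteq> []\<close> 2(1) by simp
    qed
    then have "rep (conjugate e b a) = rep b" using rep 2(1) k(1) b(1) by simp
    then have "conjugate e b a = b" by (simp only: rep_inject)
    then have "a = conjugate (\<not> e) b b" using conjugate_cancel[of e b a] by simp
    then have "a = b" by (cases e) (simp_all add: conjugate_def)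
    then show ?thesis using assms(3) by simp
  qed
qed

text \<open>Planarity forbids that \<open>a\<close> and \<open>c\<close> lie beyond the edge of \<open>b\<close> on the two wrong sides.\<close>

lemma not_dominates_both:
  assumes lt: "point a < point b" "point (- b) < point c" and unl: "point.unlinked a c"
  shows "\<not> (dominates True b a \<and> dominates False b c)"
proof
  assume "dominates True b a \<and> dominates False b c"
  then obtain v k r j s l where b: "rep b = conj_word v k" and a: "rep a = conj_word (v @ (k, True) # r) j"
      and c: "rep c = conj_word (v @ (k, False) # s) l"
    using conj_word_inject unfolding dominates_def by metis
  let ?V = "- of_word v" and ?y = "gen k"
  have b': "b = of_word v + ?y - of_word v" using of_wordD[OF b] by (simp only: of_conj_word)
  have red_v: "reduced v" "v = [] \<or> fst (last v) \<noteq> k"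
    using reduced_rep[of b] unfolding b reduced_conj_word by blast+
  have nonzero: "0 < point a" "point b > 0" "0 < point (- b)"
  proof -
    have "a \<noteq> 0" "b \<noteq> 0" using a b by (auto simp flip: rep_eq_Nil)
    then show "0 < point a" "point b > 0" "0 < point (- b)" by (auto simp: point_pos)
  qed
  have a': "vertex (?V + a) = enter (k, True)"
  proof -
    define t where "t = (k, True) # r @ (j, True) # winv (v @ (k, True) # r)"
    have t: "rep a = v @ t" using a by (simp add: t_def)
    then have "reduced t" using reduced_rep[of a] by (simp add: reduced_append)
    moreover have "?V + a = of_word t" using of_wordD[OF t] by (simp add: of_word_append flip: add.assoc)
    ultimately have "rep (?V + a) = t" by (simp add: red_reduced)
    then show ?thesis by (simp add: t_def vertex_Cons)
  qed
  have yV: "vertex (?y + ?V) = enter (k, True)"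
  proof -
    have "reduced ((k, True) # winv v)" using reduced_rep[of b] unfolding b by (simp add: reduced_append)
    moreover have "?y + ?V = of_word ((k, True) # winv v)"
      by (simp add: of_word_Cons[of _ "winv v"] of_word_winv gen_def)
    ultimately have "rep (?y + ?V) = (k, True) # winv v" by (simp only: rep_of_word red_reduced)
    then show ?thesis by (simp add: vertex_Cons)
  qed
  have V: "vertex ?V \<noteq> enter (k, True)"
  proof (cases v rule: rev_cases)
    case (snoc u q)
    then have "rep ?V = flip q # winv u" using red_v by (simp add: red_reduced)
    moreover have "flip q \<noteq> (k, True)" using red_v snoc by (cases q) auto
    ultimately show ?thesis by (simp add: vertex_Cons del: enter.simps)
  qed simp
  have c': "vertex (?y + ?V + c) \<noteq> enter (k, True)"
  proof -
    define t where "t = s @ (l, True) # winv (v @ (k, False) # s)"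
    have t: "rep c = v @ (k, False) # t" using c by (simp add: t_def)
    then have "reduced ((k, False) # t)" using reduced_rep[of c] by (simp add: reduced_append)
    then have "reduced t" "t = [] \<or> hd t \<noteq> (k, True)" by (auto simp: reduced_Cons)
    moreover have "?y + ?V + c = of_word t"
      using of_wordD[OF t]
      by (simp add: of_word_append of_word_Cons[of _ t] of_word_letter add.assoc
          diff_conv_add_uminus del: add_uminus_conv_diff)
    ultimately have "rep (?y + ?V + c) = t" "t = [] \<or> hd t \<noteq> (k, True)" by (simp_all add: red_reduced)
    then show ?thesis by (cases t) (simp_all add: vertex_def del: enter.simps)
  qed
  \<comment> \<open>After translation by \<open>?V\<close> the chord of \<open>b\<close> joins
    \<open>?V\<close> to \<open>?y + ?V\<close>, and these are the starting points of the translated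
    chords of \<open>a\<close> and \<open>c\<close>. Of the four endpoints, just
    \<open>?V + a\<close> and \<open>?y + ?V\<close> lie in the sector of \<open>(k, True)\<close>;
    with the two cyclic orders shown next this forces a crossing.\<close>
  have 1: "cyc (point ?V) (point (?V + a)) (point (?y + ?V))"
  proof -
    have "cyc (point 0) (point a) (point b)" using lt nonzero by (simp add: cyc_def)
    then have "cyc (point (?V + 0)) (point (?V + a)) (point (?V + b))" by (simp only: cyc_point)
    moreover have "?V + b = ?y + ?V" by (simp add: b' add.assoc diff_conv_add_uminus del: add_uminus_conv_diff)
    ultimately show ?thesis by simp
  qed
  have 2: "cyc (point (?y + ?V)) (point ?V) (point (?y + ?V + c))"
  proof -
    have "cyc (point 0) (point (- b)) (point c)" using lt nonzero by (simp add: cyc_def)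
    then have "cyc (point (?y + ?V + 0)) (point (?y + ?V + - b)) (point (?y + ?V + c))" by (simp only: cyc_point)
    moreover have "?y + ?V + - b = ?V"
      by (simp add: b' add.assoc diff_conv_add_uminus minus_add del: add_uminus_conv_diff)
    ultimately show ?thesis by simp
  qed
  have 3: "\<not> linked (point ?V) (point (?V + a)) (point (?y + ?V)) (point (?y + ?V + c))"
    using point.unlinkedD[OF unl] .
  have sep: "(point g < point (?V + a) \<and> point g < point (?y + ?V)) \<or>
      (point (?V + a) < point g \<and> point (?y + ?V) < point g)" if "vertex g \<noteq> enter (k, True)" for g
    using that point_less[of g "?V + a"] point_less[of g "?y + ?V"] point_less[of "?V + a" g]
      point_less[of "?y + ?V" g] a' yV by (simp del: enter.simps) linarith
  show False
    using 1 2 3 sep[OF V] sep[OF c'] unfolding linked_def cyc_def by argo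
qed

section \<open>The Hurwitz action on tuples of free group elements\<close>

definition add_grp :: "'a::group_add monoid"
  where "add_grp = \<lparr>carrier = UNIV, mult = (+), one = 0\<rparr>"

lemma add_grp_simps [simp]:
  "carrier add_grp = UNIV" "mult add_grp = (+)" "one add_grp = 0"
  by (simp_all add: add_grp_def)

lemma group_add_grp: "group add_grp"
  by (rule groupI) (auto simp: add.assoc intro: left_minus)

lemma inv_add_grp [simp]: "m_inv add_grp a = - a"
  by (rule group.inv_equality[OF group_add_grp]) simp_all

lemma hurwitz_letter_add:
  "hurwitz_letter add_grp (i, e) g =
    (if e then g(i := g (i + 1), i + 1 := conjugate True (g (i + 1)) (g i))
     else g(i := conjugate False (g i) (g (i + 1)), i + 1 := g i))"
  by (cases e) (simp_all add: conjugate_def)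

abbreviation braid_eq :: "nat \<Rightarrow> nat word \<Rightarrow> nat word \<Rightarrow> bool"
  where "braid_eq n \<equiv> pres_eq {1..<n} (braid_rels n)"

abbreviation letter :: "nat \<Rightarrow> nat \<times> bool \<Rightarrow> bool"
  where "letter n p \<equiv> fst p \<in> {1..<n}"

definition base :: "nat \<Rightarrow> nat \<Rightarrow> fgrp"
  where "base n = restrict gen {1..n}"

text \<open>Up to conventions, Artin's representation of the braid group by automorphisms of the
  free group, recorded by the images of the generators.\<close>

definition braid_image :: "nat \<Rightarrow> nat word \<Rightarrow> nat \<Rightarrow> fgrp"
  where "braid_image n w = hurwitz_word add_grp w (base n)"

lemma base_tuples: "base n \<in> tuples n add_grp"
  by (simp add: base_def tuples_def)

lemma base_apply: "k \<in> {1..n} \<Longrightarrow> base n k = gen k"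
  by (simp add: base_def)

lemma braid_image_Nil [simp]: "braid_image n [] = base n"
  by (simp add: braid_image_def hurwitz_word_def)

lemma braid_image_Cons [simp]: "braid_image n (p # w) = hurwitz_letter add_grp p (braid_image n w)"
  by (simp add: braid_image_def hurwitz_word_def)

lemma braid_image_eq: "braid_eq n v w \<Longrightarrow> braid_image n v = braid_image n w"
  unfolding braid_image_def by (rule group.hurwitz_word_pres_eq[OF group_add_grp _ base_tuples])

lemma braid_image_tuples: "w \<in> words {1..<n} \<Longrightarrow> braid_image n w \<in> tuples n add_grp"
  unfolding braid_image_def by (rule group.hurwitz_word_closed[OF group_add_grp _ base_tuples])

definition planar :: "nat \<Rightarrow> (nat \<Rightarrow> fgrp) \<Rightarrow> bool"
  where "planar n g \<longleftrightarrow> point.admissible n g \<and> (\<forall>k\<in>{1..n}. is_conj (g k) \<and> g k \<in> letters_in {1..n})"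

lemma letters_in_conjugate: "a \<in> letters_in X \<Longrightarrow> b \<in> letters_in X \<Longrightarrow> conjugate e b a \<in> letters_in X"
  by (auto simp: conjugate_def diff_conv_add_uminus letters_in_add letters_in_minus simp del: add_uminus_conv_diff)

lemma planar_hurwitz_letter:
  assumes "planar n g" "letter n p"
  shows "planar n (hurwitz_letter add_grp p g)"
proof -
  obtain i e where p: "p = (i, e)" by (cases p)
  have i: "1 \<le> i" "i < n" using assms(2) p by auto
  have "point.admissible n (hurwitz_letter add_grp p g)"
    using point.admissible_step[of n g i] point.admissible_step_inverse[of n g i] assms(1) i
    by (cases e) (simp_all add: p planar_def)
  moreover have "is_conj (hurwitz_letter add_grp p g k) \<and> hurwitz_letter add_grp p g k \<in> letters_in {1..n}"
    if "k \<in> {1..n}" for k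
    using assms(1) i that
    by (auto simp: p hurwitz_letter_add planar_def is_conj_conjugate intro!: letters_in_conjugate
      simp del: hurwitz_letter.simps)
  ultimately show ?thesis by (simp add: planar_def)
qed

lemma planar_braid_image: "w \<in> words {1..<n} \<Longrightarrow> planar n (braid_image n w)"
proof (induction w)
  case Nil
  have "point.admissible n (base n)"
    using admissible_gen point.admissible_cong[of n "base n" gen] by (simp add: base_apply)
  then show ?case by (auto simp: planar_def base_apply letters_in_gen)
next
  case (Cons p w)
  then show ?case using planar_hurwitz_letter[of n _ p] by simp
qed

lemma planar_distinct:
  assumes "planar n g" "k \<in> {1..n}" "l \<in> {1..n}" "k < l"
  shows "point (g k) < point (g l)" "point (- g k) < point (g l)" "g k \<noteq> g l"
proof -
  show 1: "point (- g k) < point (g l)"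
    using assms by (simp add: planar_def point.admissible_def)
  moreover have "point (g k) < point (- g k)"
    using assms by (simp add: planar_def point.admissible_def)
  ultimately show "point (g k) < point (g l)" by simp
  then show "g k \<noteq> g l" by auto
qed

section \<open>Total length and the moves that decrease it\<close>

definition total_length :: "nat \<Rightarrow> (nat \<Rightarrow> fgrp) \<Rightarrow> nat"
  where "total_length n g = (\<Sum>k\<in>{1..n}. norm_len (g k))"

lemma total_length_less:
  assumes "S \<subseteq> {1..n}" "\<And>k. k \<in> {1..n} - S \<Longrightarrow> g' k = g k"
    and "(\<Sum>k\<in>S. norm_len (g' k)) < (\<Sum>k\<in>S. norm_len (g k))"
  shows "total_length n g' < total_length n g"
proof -
  have "total_length n h = (\<Sum>k\<in>{1..n} - S. norm_len (h k)) + (\<Sum>k\<in>S. norm_len (h k))" for h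
    unfolding total_length_def using assms(1) by (intro sum.subset_diff) auto
  moreover have "(\<Sum>k\<in>{1..n} - S. norm_len (g' k)) = (\<Sum>k\<in>{1..n} - S. norm_len (g k))"
    using assms(2) by (intro sum.cong) auto
  ultimately show ?thesis using assms(3) by simp
qed

lemma total_length_base: "w \<in> words {1..<n} \<Longrightarrow> total_length n (base n) \<le> total_length n (braid_image n w)"
  unfolding total_length_def
proof (rule sum_mono)
  fix k assume "w \<in> words {1..<n}" "k \<in> {1..n}"
  then have "is_conj (braid_image n w k)" using planar_braid_image by (simp add: planar_def)
  then show "norm_len (base n k) \<le> norm_len (braid_image n w k)"
    using \<open>k \<in> {1..n}\<close> by (auto simp: base_apply is_conj_def)
qed

fun descends :: "nat \<times> bool \<Rightarrow> (nat \<Rightarrow> fgrp) \<Rightarrow> bool"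
  where "descends (i, e) g = (if e then dominates True (g (i + 1)) (g i) else dominates False (g i) (g (i + 1)))"

lemma descends_less:
  assumes "letter n p" "descends p g"
  shows "total_length n (hurwitz_letter add_grp p g) < total_length n g"
proof -
  obtain i e where p: "p = (i, e)" by (cases p)
  have "{i, i + 1} \<subseteq> {1..n}" using assms(1) p by auto
  then show ?thesis
    by (rule total_length_less)
      (use assms(2) dominates_length in
        \<open>auto simp: p hurwitz_letter_add split: if_splits simp del: hurwitz_letter.simps\<close>)
qed

lemma descends_flip:
  assumes "planar n g" "letter n p" "\<not> descends p g"
  shows "descends (flip p) (hurwitz_letter add_grp p g)"
proof -
  obtain i e where p: "p = (i, e)" by (cases p)
  have i: "i \<in> {1..n}" "i + 1 \<in> {1..n}" using assms(2) p by auto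
  have "is_conj (g i)" "is_conj (g (i + 1))" "g i \<noteq> g (i + 1)"
    using assms(1) i planar_distinct(3)[OF assms(1) i] by (auto simp: planar_def)
  then show ?thesis
    using assms(3) dominates_conjugate[of "g i" "g (i + 1)" True] dominates_conjugate[of "g (i + 1)" "g i" False]
    by (cases e) (auto simp: p hurwitz_letter_add simp del: hurwitz_letter.simps)
qed

lemma hurwitz_letter_flip:
  "hurwitz_letter add_grp (flip p) (hurwitz_letter add_grp p g) = g"
proof -
  obtain i e where p: "p = (i, e)" by (cases p)
  show ?thesis
    using conjugate_cancel[of True "g (i + 1)" "g i"] conjugate_cancel[of False "g i" "g (i + 1)"]
    by (cases e) (auto simp: p hurwitz_letter_add fun_eq_iff simp del: hurwitz_letter.simps conjugate_cancel)
qed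

text \<open>Together with \<open>descends_less\<close> this shows that no letter preserves the
  length of a planar tuple, so that the peak reduction meets no plateaus.\<close>

lemma ascends_or_descends:
  assumes "planar n g" "letter n p"
  shows "descends p g \<or> total_length n g < total_length n (hurwitz_letter add_grp p g)"
  using descends_flip[OF assms] descends_less[of "flip p" n "hurwitz_letter add_grp p g"] assms(2)
    hurwitz_letter_flip[of p g] by auto

lemma not_descends_flip: "descends p g \<Longrightarrow> \<not> descends (flip p) g"
  using dominates_longer by (cases p) (fastforce split: if_splits dest: dominates_longer)


section \<open>Braid relations\<close>

lemma braid_eq_trans [trans]: "braid_eq n u v \<Longrightarrow> braid_eq n v w \<Longrightarrow> braid_eq n u w"
  by (rule pres_eq.trans)

lemma braid_eq_flip: "w \<in> words {1..<n} \<Longrightarrow> letter n p \<Longrightarrow> braid_eq n (flip p # p # w) w"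
  using pres_eq.cancel[of "[]" "{1..<n}" w "fst p" "braid_rels n" "\<not> snd p"] by (cases p) simp

lemma braid_eq_append: "braid_eq n v w \<Longrightarrow> u \<in> words {1..<n} \<Longrightarrow> braid_eq n (v @ u) (w @ u)"
  using pres_eq_context[of "{1..<n}" "braid_rels n" v w "[]" u] by simp

lemma braid_eq_iff:
  "v \<in> words {1..<n} \<Longrightarrow> braid_eq n v w \<longleftrightarrow> braid_class n v = braid_class n w"
  by (simp add: braid_class_def word_class_eq_iff)

lemma braid_class_Nil: "braid_class n [] = \<one>\<^bsub>braid_group n\<^esub>"
  by (simp add: braid_group_def presented_group_def braid_class_def)

lemma braid_class_append:
  "v \<in> words {1..<n} \<Longrightarrow> w \<in> words {1..<n} \<Longrightarrow>
    braid_class n (v @ w) = braid_class n v \<otimes>\<^bsub>braid_group n\<^esub> braid_class n w"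
  by (simp add: braid_class_mult)

lemma braid_class_winv:
  assumes "w \<in> words {1..<n}"
  shows "braid_class n (rev (map (apsnd Not) w)) = inv\<^bsub>braid_group n\<^esub> braid_class n w"
proof -
  interpret group "braid_group n" by (rule group_braid_group)
  have v: "rev (map (apsnd Not) w) \<in> words {1..<n}" using assms by simp
  have "braid_class n (rev (map (apsnd Not) w) @ w) = braid_class n []"
    using braid_eq_iff[of "rev (map (apsnd Not) w) @ w" n "[]"]
      pres_eq_inverse[OF assms, of "braid_rels n"] assms v by simp
  then show ?thesis
    using assms v by (intro inv_equality[symmetric]) (simp_all add: braid_class_append braid_class_Nil braid_class_closed)
qed

context group
begin

lemma braid_relation_conj:
  assumes "x \<in> carrier G" "y \<in> carrier G" "x \<otimes> y \<otimes> x = y \<otimes> x \<otimes> y"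
  shows "x \<otimes> y \<otimes> inv x = inv y \<otimes> x \<otimes> y"
proof -
  have "y \<otimes> (x \<otimes> y \<otimes> inv x) = (y \<otimes> x \<otimes> y) \<otimes> inv x"
    using assms(1,2) by (simp add: m_assoc)
  also have "\<dots> = x \<otimes> y"
    unfolding assms(3)[symmetric] using assms(1,2) by (simp add: m_assoc)
  also have "\<dots> = y \<otimes> (inv y \<otimes> x \<otimes> y)"
    using assms(1,2) by (simp flip: m_assoc)
  finally show ?thesis using assms(1,2) by simp
qed

lemma braid_relation_inverse:
  assumes "x \<in> carrier G" "y \<in> carrier G" "x \<otimes> y \<otimes> x = y \<otimes> x \<otimes> y"
  shows "inv x \<otimes> inv y \<otimes> inv x = inv y \<otimes> inv x \<otimes> inv y"
    "x \<otimes> inv y \<otimes> inv x = inv y \<otimes> inv x \<otimes> y"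
  using arg_cong[OF assms(3), of "m_inv G"] arg_cong[OF braid_relation_conj[OF assms], of "m_inv G"] assms(1,2)
  by (simp_all add: inv_mult_group m_assoc)

lemma commute_inverse:
  assumes "x \<in> carrier G" "y \<in> carrier G" "x \<otimes> y = y \<otimes> x"
  shows "x \<otimes> inv y = inv y \<otimes> x"
proof -
  have "x \<otimes> inv y = inv y \<otimes> (y \<otimes> x) \<otimes> inv y"
    using assms(1,2) by (simp flip: m_assoc)
  also have "\<dots> = inv y \<otimes> x"
    unfolding assms(3)[symmetric] using assms(1,2) by (simp add: m_assoc)
  finally show ?thesis .
qed

end

definition sigma :: "nat \<Rightarrow> nat \<times> bool \<Rightarrow> nat word set"
  where "sigma n p = braid_class n [p]"

lemma sigma_closed [simp]: "letter n p \<Longrightarrow> sigma n p \<in> carrier (braid_group n)"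
  by (simp add: sigma_def braid_class_closed)

lemma sigma_False: "letter n (i, True) \<Longrightarrow> sigma n (i, False) = inv\<^bsub>braid_group n\<^esub> sigma n (i, True)"
  using braid_class_winv[of "[(i, True)]" n] by (simp add: sigma_def)

lemma braid_class_three:
  "letter n p \<Longrightarrow> letter n q \<Longrightarrow> letter n r \<Longrightarrow>
    braid_class n [p, q, r] = sigma n p \<otimes>\<^bsub>braid_group n\<^esub> sigma n q \<otimes>\<^bsub>braid_group n\<^esub> sigma n r"
  by (simp add: sigma_def braid_class_mult)

lemma braid_rel:
  assumes "(r, s) \<in> braid_rels n" "r \<in> words {1..<n}" "s \<in> words {1..<n}"
  shows "braid_eq n r s"
  using pres_eq.rel[of "[]" "{1..<n}" "[]" r s "braid_rels n"] assms by simp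

text \<open>The rightmost letters are the moves applied first. The sign patterns of these pairs are
  the ones that occur when two adjacent moves both shorten a planar tuple.\<close>

lemma braid_eq_three:
  assumes "1 \<le> i" "i + 1 < n"
  shows "braid_eq n [(i, e), (i + 1, e), (i, e)] [(i + 1, e), (i, e), (i + 1, e)]"
    and "braid_eq n [(i, True), (i + 1, e), (i, False)] [(i + 1, False), (i, e), (i + 1, True)]"
proof -
  interpret group "braid_group n" by (rule group_braid_group)
  let ?x = "sigma n (i, True)" and ?y = "sigma n (i + 1, True)"
  have xy: "?x \<in> carrier (braid_group n)" "?y \<in> carrier (braid_group n)" using assms by auto
  have "braid_eq n [(i, True), (i + 1, True), (i, True)] [(i + 1, True), (i, True), (i + 1, True)]"
    using assms by (intro braid_rel) (auto simp: braid_rels_def)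
  then have rel: "?x \<otimes>\<^bsub>braid_group n\<^esub> ?y \<otimes>\<^bsub>braid_group n\<^esub> ?x = ?y \<otimes>\<^bsub>braid_group n\<^esub> ?x \<otimes>\<^bsub>braid_group n\<^esub> ?y"
    using assms by (simp add: braid_eq_iff braid_class_three del: One_nat_def)
  show "braid_eq n [(i, e), (i + 1, e), (i, e)] [(i + 1, e), (i, e), (i + 1, e)]"
    using assms rel braid_relation_inverse(1)[OF xy rel]
    by (cases e) (simp_all add: braid_eq_iff braid_class_three sigma_False del: One_nat_def)
  show "braid_eq n [(i, True), (i + 1, e), (i, False)] [(i + 1, False), (i, e), (i + 1, True)]"
    using assms braid_relation_conj[OF xy rel] braid_relation_inverse(2)[OF xy rel]
    by (cases e) (simp_all add: braid_eq_iff braid_class_three sigma_False del: One_nat_def)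
qed

lemma braid_eq_commute:
  assumes "letter n p" "letter n q" "fst p + 2 \<le> fst q"
  shows "braid_eq n [p, q] [q, p]"
proof -
  interpret group "braid_group n" by (rule group_braid_group)
  obtain i e j e' where [simp]: "p = (i, e)" "q = (j, e')" by (metis surj_pair)
  let ?x = "sigma n (i, True)" and ?y = "sigma n (j, True)"
  have xy: "?x \<in> carrier (braid_group n)" "?y \<in> carrier (braid_group n)" using assms by auto
  have two: "braid_class n [a, b] = sigma n a \<otimes>\<^bsub>braid_group n\<^esub> sigma n b" if "letter n a" "letter n b" for a b
    using that by (simp add: sigma_def braid_class_mult)
  have "braid_eq n [(i, True), (j, True)] [(j, True), (i, True)]"
    using assms by (intro braid_rel) (auto simp: braid_rels_def)
  then have rel: "?x \<otimes>\<^bsub>braid_group n\<^esub> ?y = ?y \<otimes>\<^bsub>braid_group n\<^esub> ?x"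
    using assms by (simp add: braid_eq_iff two del: One_nat_def)
  note rel' = commute_inverse[OF xy rel] commute_inverse[OF xy(2,1) rel[symmetric]]
  have "inv\<^bsub>braid_group n\<^esub> ?x \<otimes>\<^bsub>braid_group n\<^esub> inv\<^bsub>braid_group n\<^esub> ?y =
      inv\<^bsub>braid_group n\<^esub> ?y \<otimes>\<^bsub>braid_group n\<^esub> inv\<^bsub>braid_group n\<^esub> ?x"
    using commute_inverse[of "inv\<^bsub>braid_group n\<^esub> ?x" ?y] rel' xy by simp
  then show ?thesis
    using assms rel rel' by (cases e; cases e') (simp_all add: braid_eq_iff two sigma_False del: One_nat_def)
qed


section \<open>Peak reduction: the Hurwitz action on the base tuple is free\<close>

text \<open>Rule \<open>eq\<close> makes this a property of the braid, so that relations may be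
  applied anywhere along a path.\<close>

inductive ascending :: "nat \<Rightarrow> nat word \<Rightarrow> bool"
  for n :: nat
  where
    Nil: "ascending n []"
  | step: "ascending n w \<Longrightarrow> letter n p \<Longrightarrow>
      total_length n (braid_image n w) < total_length n (braid_image n (p # w)) \<Longrightarrow> ascending n (p # w)"
  | eq: "ascending n w \<Longrightarrow> braid_eq n w w' \<Longrightarrow> ascending n w'"

lemma ascending_words: "ascending n w \<Longrightarrow> w \<in> words {1..<n}"
  by (induction rule: ascending.induct) (auto dest: pres_eq_words)

lemma ascending_cong: "braid_eq n v w \<Longrightarrow> ascending n v \<longleftrightarrow> ascending n w"
  by (metis ascending.eq pres_eq.sym)

lemma ascending_cases:
  assumes "ascending n w"
  shows "braid_eq n w [] \<or> (\<exists>p v. ascending n v \<and> letter n p \<and> braid_eq n w (p # v) \<and>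
    total_length n (braid_image n v) < total_length n (braid_image n w))"
  using assms
proof (induction rule: ascending.induct)
  case Nil
  then show ?case by (simp add: pres_eq.refl)
next
  case (step w p)
  then have "braid_eq n (p # w) (p # w)" using ascending_words by (intro pres_eq.refl) simp
  then show ?case using step by blast
next
  case (eq w w')
  then show ?case using braid_image_eq[OF eq(2)] by (metis pres_eq.sym pres_eq.trans)
qed

text \<open>Here \<open>w\<close> is the peak, and \<open>IH\<close> is the induction hypothesis of
  the peak reduction: below the length of \<open>w\<close>, every letter keeps a word
  ascending.\<close>

context
  fixes n :: nat and w :: "nat word"
  assumes w: "w \<in> words {1..<n}"
    and IH: "\<And>v p. ascending n v \<Longrightarrow> letter n p \<Longrightarrow>
      total_length n (braid_image n v) < total_length n (braid_image n w) \<Longrightarrow> ascending n (p # v)"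
begin

abbreviation low :: "nat word \<Rightarrow> bool"
  where "low v \<equiv> total_length n (braid_image n v) < total_length n (braid_image n w)"

lemma ascending_edge:
  assumes "v \<in> words {1..<n}" "letter n p" "low v" "low (p # v)"
  shows "ascending n v \<longleftrightarrow> ascending n (p # v)"
proof
  assume "ascending n (p # v)"
  then have "ascending n (flip p # p # v)" using assms IH by simp
  then show "ascending n v" by (rule ascending.eq[OF _ braid_eq_flip[OF assms(1,2)]])
qed (use assms IH in simp)

text \<open>The two neighbours of the peak are joined by the other vertices of the relation hexagon.
  All of these are low, so \<open>ascending_edge\<close> carries the property from one to the
  next.\<close>

lemma ascending_hexagon:
  assumes "braid_eq n [p3, p2, p1] [q3, q2, q1]"
    and "low (p1 # w)" "low (p2 # p1 # w)" "low (p3 # p2 # p1 # w)" "low (q2 # q1 # w)" "low (q1 # w)"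
  shows "ascending n (p1 # w) \<longleftrightarrow> ascending n (q1 # w)"
proof -
  have letters: "letter n p1" "letter n p2" "letter n p3" "letter n q1" "letter n q2" "letter n q3"
    using pres_eq_words[OF assms(1)] by simp_all
  have eq: "braid_eq n (p3 # p2 # p1 # w) (q3 # q2 # q1 # w)"
    using braid_eq_append[OF assms(1) w] by simp
  then have "low (q3 # q2 # q1 # w)" using assms(4) by (metis braid_image_eq)
  then show ?thesis
    using ascending_edge[of "p1 # w" p2] ascending_edge[of "p2 # p1 # w" p3] ascending_edge[of "q1 # w" q2]
      ascending_edge[of "q2 # q1 # w" q3] ascending_cong[OF eq] assms letters w by simp
qed

lemma ascending_square:
  assumes "braid_eq n [p2, p1] [q2, q1]"
    and "low (p1 # w)" "low (p2 # p1 # w)" "low (q1 # w)"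
  shows "ascending n (p1 # w) \<longleftrightarrow> ascending n (q1 # w)"
proof -
  have letters: "letter n p1" "letter n p2" "letter n q1" "letter n q2"
    using pres_eq_words[OF assms(1)] by simp_all
  have eq: "braid_eq n (p2 # p1 # w) (q2 # q1 # w)"
    using braid_eq_append[OF assms(1) w] by simp
  then have "low (q2 # q1 # w)" using assms(3) by (metis braid_image_eq)
  then show ?thesis
    using ascending_edge[of "p1 # w" p2] ascending_edge[of "q1 # w" q2]
      ascending_cong[OF eq] assms letters w by simp
qed

lemma low_three:
  assumes "1 \<le> i" "i + 1 < n" "set ps \<subseteq> {i, i + 1} \<times> UNIV"
    and "norm_len (braid_image n (ps @ w) i) + norm_len (braid_image n (ps @ w) (i + 1)) + norm_len (braid_image n (ps @ w) (i + 2))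
      < norm_len (braid_image n w i) + norm_len (braid_image n w (i + 1)) + norm_len (braid_image n w (i + 2))"
  shows "low (ps @ w)"
proof (rule total_length_less)
  show "{i, i + 1, i + 2} \<subseteq> {1..n}" using assms by auto
  show "braid_image n (ps @ w) k = braid_image n w k" if "k \<in> {1..n} - {i, i + 1, i + 2}" for k
    using assms(3)
  proof (induction ps)
    case (Cons p ps)
    then show ?case using that
      by (cases p) (auto simp: hurwitz_letter_add simp del: hurwitz_letter.simps)
  qed simp
qed (use assms(4) in simp)

lemma ascending_adjacent:
  assumes i: "1 \<le> i" "i + 1 < n" and desc: "descends (i, e) (braid_image n w)" "descends (i + 1, e') (braid_image n w)"
  shows "ascending n ((i, e) # w) \<longleftrightarrow> ascending n ((i + 1, e') # w)"
proof -
  define a b c where abc: "a = braid_image n w i" "b = braid_image n w (Suc i)" "c = braid_image n w (Suc (Suc i))"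
  have planar: "planar n (braid_image n w)" by (rule planar_braid_image[OF w])
  note low = low_three[OF i]
  note simps = hurwitz_letter_add conjugate_conjugate abc[symmetric]
  consider "e" "e'" | "\<not> e" "\<not> e'" | "\<not> e" "e'" | "e" "\<not> e'" by blast
  then show ?thesis
  proof cases
    case 1
    then have d: "dominates True b a" "dominates True c b" using desc by (simp_all add: abc)
    note less = d[THEN dominates_length] dominates_trans_length(2)[OF d]
      dominates_length[OF dominates_trans_length(1)[OF d]]
    have "ascending n ((i, True) # w) \<longleftrightarrow> ascending n ((i + 1, True) # w)"
      by (rule ascending_hexagon[OF braid_eq_three(1)[OF i]])
        (use less i low[of "[(i, True)]"] low[of "[(i + 1, True), (i, True)]"]
          low[of "[(i, True), (i + 1, True), (i, True)]"] low[of "[(i, True), (i + 1, True)]"]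
          low[of "[(i + 1, True)]"] in \<open>simp_all add: simps del: hurwitz_letter.simps\<close>)
    then show ?thesis using 1 by simp
  next
    case 2
    then have d: "dominates False b c" "dominates False a b" using desc by (simp_all add: abc)
    note less = d[THEN dominates_length] dominates_trans_length(2)[OF d]
      dominates_length[OF dominates_trans_length(1)[OF d]]
    have "ascending n ((i, False) # w) \<longleftrightarrow> ascending n ((i + 1, False) # w)"
      by (rule ascending_hexagon[OF braid_eq_three(1)[OF i]])
        (use less i low[of "[(i, False)]"] low[of "[(i + 1, False), (i, False)]"]
          low[of "[(i, False), (i + 1, False), (i, False)]"] low[of "[(i, False), (i + 1, False)]"]
          low[of "[(i + 1, False)]"] in \<open>simp_all add: simps del: hurwitz_letter.simps\<close>)
    then show ?thesis using 2 by simp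
  next
    case 3
    then have d: "dominates False a b" "dominates True c b" using desc by (simp_all add: abc)
    have "ascending n ((i, False) # w) \<longleftrightarrow> ascending n ((i + 1, True) # w)"
    \<comment> \<open>The edge of \<open>b\<close> lies beyond those of \<open>a\<close> and
      \<open>c\<close>. Which of these two is nearer to the root decides the sign of the middle
      letter of the hexagon.\<close>
    proof (cases "dominates False a c")
      case True
      note less = True[THEN dominates_length] d[THEN dominates_length] dominates_trans_length(2)[OF d(2) True]
      show ?thesis
        by (rule ascending_hexagon[OF braid_eq_three(2)[OF i, of False]])
          (use less i low[of "[(i, False)]"] low[of "[(i + 1, False), (i, False)]"]
            low[of "[(i, True), (i + 1, False), (i, False)]"] low[of "[(i, False), (i + 1, True)]"]
            low[of "[(i + 1, True)]"] in \<open>simp_all add: simps del: hurwitz_letter.simps\<close>)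
    next
      case False
      then have ca: "dominates True c a" using dominates_comparable[OF d] by simp
      note less = ca[THEN dominates_length] d[THEN dominates_length] dominates_trans_length(2)[OF d(1) ca]
      show ?thesis
        by (rule ascending_hexagon[OF braid_eq_three(2)[OF i, of True]])
          (use less i low[of "[(i, False)]"] low[of "[(i + 1, True), (i, False)]"]
            low[of "[(i, True), (i + 1, True), (i, False)]"] low[of "[(i, True), (i + 1, True)]"]
            low[of "[(i + 1, True)]"] in \<open>simp_all add: simps del: hurwitz_letter.simps\<close>)
    qed
    then show ?thesis using 3 by simp
  next
    case 4
    have "point.unlinked a c" using planar i by (simp add: planar_def point.admissible_def abc)
    then have "\<not> (dominates True b a \<and> dominates False b c)"
      using not_dominates_both[of a b c] planar_distinct[OF planar, of i "Suc i"]
        planar_distinct[OF planar, of "Suc i" "Suc (Suc i)"] i by (simp add: abc)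
    then show ?thesis using desc 4 by (simp add: abc)
  qed
qed

end

lemma ascending_Cons: "ascending n w \<Longrightarrow> letter n p \<Longrightarrow> ascending n (p # w)"
proof (induction "total_length n (braid_image n w)" arbitrary: w p rule: less_induct)
  case less
  have w: "w \<in> words {1..<n}" by (rule ascending_words[OF less.prems(1)])
  have IH: "ascending n (q # v)"
    if "ascending n v" "letter n q" "total_length n (braid_image n v) < total_length n (braid_image n w)" for v q
    using less.hyps[OF that(3,1,2)] .
  have planar: "planar n (braid_image n w)" by (rule planar_braid_image[OF w])
  show ?case
  proof (cases "total_length n (braid_image n w) < total_length n (braid_image n (p # w))")
    case True
    then show ?thesis by (rule ascending.step[OF less.prems])
  next
    case False
    then have p: "descends p (braid_image n w)"
      using ascends_or_descends[OF planar less.prems(2)] by auto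
    from descends_less[OF less.prems(2) p]
    have low_p: "total_length n (braid_image n (p # w)) < total_length n (braid_image n w)" by simp
    have "\<not> braid_eq n w []"
    proof
      assume "braid_eq n w []"
      then show False
        using braid_image_eq[of n w "[]"] low_p total_length_base[of "p # w" n] w less.prems(2) by simp
    qed
    then obtain r v where v: "ascending n v" "letter n r" "braid_eq n w (r # v)"
        "total_length n (braid_image n v) < total_length n (braid_image n w)"
      using ascending_cases[OF less.prems(1)] by blast
    \<comment> \<open>Walking back the last step of an ascending path gives a descent
      \<open>q\<close> from \<open>w\<close> to an ascending word. The given descent
      \<open>p\<close> is compared with it.\<close>
    define q where "q = flip r"
    have q: "letter n q" using v(2) by (simp add: q_def)
    have "braid_eq n (q # w) (q # r # v)"
      using pres_eq_context[OF v(3), of "[q]" "[]"] q by simp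
    also have "braid_eq n (q # r # v) v"
      unfolding q_def using v(2) ascending_words[OF v(1)] by (intro braid_eq_flip)
    finally have qw: "braid_eq n (q # w) v" .
    then have asc_q: "ascending n (q # w)" using v(1) ascending_cong by blast
    have low_q: "total_length n (braid_image n (q # w)) < total_length n (braid_image n w)"
      using v(4) braid_image_eq[OF qw] by simp
    then have desc_q: "descends q (braid_image n w)"
      using ascends_or_descends[OF planar q] by auto
    have square: "ascending n (x # w) \<longleftrightarrow> ascending n (y # w)"
      if "fst x + 2 \<le> fst y" "letter n x" "letter n y"
        "descends x (braid_image n w)" "descends y (braid_image n w)" for x y
    proof (rule ascending_square[OF w IH braid_eq_commute[OF that(2,3,1), THEN pres_eq.sym]])
      have "descends y (hurwitz_letter add_grp x (braid_image n w))"
        using that(1,5) by (cases x; cases y) (auto simp: hurwitz_letter_add simp del: hurwitz_letter.simps)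
      from descends_less[OF that(3) this] descends_less[OF that(2,4)]
      show "total_length n (braid_image n (y # x # w)) < total_length n (braid_image n w)" by simp
    qed (use descends_less that in simp_all)
    have adjacent: "ascending n (x # w) \<longleftrightarrow> ascending n (y # w)"
      if "fst y = fst x + 1" "letter n x" "letter n y"
        "descends x (braid_image n w)" "descends y (braid_image n w)" for x y
      using ascending_adjacent[OF w IH, of "fst x" "snd x" "snd y"] that by (cases x; cases y) simp
    consider "fst p = fst q" | "fst p + 2 \<le> fst q" | "fst q + 2 \<le> fst p" | "fst q = fst p + 1" | "fst p = fst q + 1"
      by linarith
    then show ?thesis
    proof cases
      case 1
      then have "p = q \<or> p = flip q" by (cases p; cases q) auto
      then show ?thesis using asc_q not_descends_flip[OF desc_q] p by auto
    qed (use square[of p q] square[of q p] adjacent[of p q] adjacent[of q p] p desc_q asc_q q less.prems(2) in auto)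
  qed
qed

theorem braid_image_base_imp_trivial:
  assumes "w \<in> words {1..<n}" "braid_image n w = base n"
  shows "braid_eq n w []"
proof -
  have "ascending n w" using assms(1)
    by (induction w) (auto intro: ascending.Nil ascending_Cons)
  from ascending_cases[OF this] show ?thesis
    using total_length_base[OF ascending_words] assms(2) by fastforce
qed

section \<open>Half twists shorten non-tight tuples\<close>

abbreviation exit :: "nat \<times> bool \<Rightarrow> nat"
  where "exit p \<equiv> enter (flip p)"

text \<open>The path of a word in the planar tree traverses, at each vertex, the polygon of
  directions from the side through which it came to the side of its next letter. With
  \<open>A = 0\<close> the path also starts at the base point.\<close>

fun chords :: "nat \<Rightarrow> nat word \<Rightarrow> (nat \<times> nat) set"
  where
    "chords A [] = {(A, 0)}"
  | "chords A (p # w) = insert (A, enter p) (chords (exit p) w)"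

definition first_vertex :: "nat word \<Rightarrow> nat"
  where "first_vertex w = (case w of [] \<Rightarrow> 0 | p # _ \<Rightarrow> enter p)"

lemma first_vertex_simps [simp]: "first_vertex [] = 0" "first_vertex (p # w) = enter p"
  by (simp_all add: first_vertex_def)

lemma vertex_first: "vertex a = first_vertex (rep a)"
  by (simp add: vertex_def first_vertex_def)

lemma chords_first: "(A, first_vertex w) \<in> chords A w"
  by (cases w) simp_all

lemma chords_split:
  "(A, B) \<in> chords C w \<Longrightarrow>
    \<exists>u v. w = u @ v \<and> A = (if u = [] then C else exit (last u)) \<and> B = first_vertex v"
proof (induction w arbitrary: C)
  case (Cons p w)
  show ?case
  proof (cases "(A, B) = (C, enter p)")
    case True
    then show ?thesis by (intro exI[of _ "[]"] exI[of _ "p # w"]) simp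
  next
    case False
    then have "(A, B) \<in> chords (exit p) w" using Cons.prems by auto
    from Cons.IH[OF this] obtain u v where "w = u @ v"
      "A = (if u = [] then exit p else exit (last u))" "B = first_vertex v" by blast
    then show ?thesis by (intro exI[of _ "p # u"] exI[of _ v]) simp
  qed
qed simp

lemma chords_append: "(exit p, enter q) \<in> chords A (u @ p # q # v)"
  by (induction u arbitrary: A) auto

text \<open>Moving the vertex that carries the chord to the identity makes the two ends of the path
  lie in the two directions of the chord.\<close>

lemma chord_endpoints:
  assumes "(A, B) \<in> chords 0 (rep a)"
  obtains g where "vertex g = A" "vertex (g + a) = B"
proof -
  obtain u v where uv: "rep a = u @ v" "A = (if u = [] then 0 else exit (last u))" "B = first_vertex v"
    using chords_split[OF assms] by blast
  have red: "reduced u" "reduced v" using reduced_rep[of a] unfolding uv by (simp_all add: reduced_append)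
  have "- of_word u + a = of_word v" using of_wordD[OF uv(1)] by (simp add: of_word_append flip: add.assoc)
  then have "vertex (- of_word u + a) = B" using red uv(3) by (simp add: vertex_first red_reduced)
  moreover have "vertex (- of_word u) = A"
    using red uv(2) by (cases u rule: rev_cases) (simp_all add: vertex_first red_reduced)
  ultimately show ?thesis using that by blast
qed

text \<open>Points in different directions are ordered like the directions, so crossing chords would
  give linked translates of \<open>a\<close> and \<open>b\<close>.\<close>

lemma chords_not_linked:
  assumes "point.unlinked a b" "(A, B) \<in> chords 0 (rep a)" "(C, D) \<in> chords 0 (rep b)"
  shows "\<not> linked (real A) (real B) (real C) (real D)"
proof -
  obtain g where g: "vertex g = A" "vertex (g + a) = B" using chord_endpoints[OF assms(2)] .
  obtain h where h: "vertex h = C" "vertex (h + b) = D" using chord_endpoints[OF assms(3)] .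
  have cyc: "cyc (point x) (point y) (point z)"
    if "cyc (real (vertex x)) (real (vertex y)) (real (vertex z))" for x y z
    using that point_less unfolding cyc_def by (metis of_nat_less_iff)
  show ?thesis
    using point.unlinkedD[OF assms(1), of g h] cyc unfolding linked_def g[symmetric] h[symmetric] by blast
qed

text \<open>For \<open>d = True\<close> this is the action of \<open>a\<^sub>i\<^sub>j\<close> on the generators, for \<open>d = False\<close> that of its inverse.\<close>

definition twist :: "nat \<Rightarrow> nat \<Rightarrow> bool \<Rightarrow> nat \<Rightarrow> fgrp"
  where "twist i j d k = (let c = (if d then - gen j + gen i else gen i - gen j) in
    if k = i then (if d then gen j else gen i + gen j - gen i)
    else if k = j then (if d then - gen j + gen i + gen j else gen i)
    else if i < k \<and> k < j then c + gen k - c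
    else gen k)"

text \<open>The arc of the twist joins the punctures \<open>i\<close> and \<open>j\<close>; it separates the polygon obtained by cutting
  the disc along the rays of all punctures. A word none of whose chords crosses this arc can be rewritten letter
  by letter: only the letters \<open>i\<close> and \<open>j\<close> may be exchanged, depending on the side on which the adjacent
  chord lies.\<close>

context
  fixes i j :: nat and d :: bool
  assumes ij: "i < j"
begin

abbreviation inner :: "nat \<Rightarrow> bool"
  where "inner A \<equiv> enter (i, \<not> d) < A \<and> A < enter (j, \<not> d)"

definition side :: "nat \<Rightarrow> nat \<Rightarrow> bool"
  where "side A B \<longleftrightarrow> inner A \<or> inner B"

definition uncrossed :: "nat \<times> nat \<Rightarrow> bool"
  where "uncrossed = (\<lambda>(A, B).
    (inner A \<longrightarrow> enter (i, \<not> d) \<le> B \<and> B \<le> enter (j, \<not> d)) \<and>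
    (inner B \<longrightarrow> enter (i, \<not> d) \<le> A \<and> A \<le> enter (j, \<not> d)))"

text \<open>Here \<open>s\<close> and \<open>s'\<close> are the sides of the chords before and after
  the letter. The one consulted touches an end of the arc, in direction
  \<open>(fst p, \<not> d)\<close>; the other lies on a side determined by \<open>d\<close> and
  \<open>fst p\<close>.\<close>

definition relabel_letter :: "bool \<Rightarrow> bool \<Rightarrow> nat \<times> bool \<Rightarrow> nat \<times> bool"
  where "relabel_letter s s' p =
    (if fst p \<in> {i, j} then (if (if snd p = d then s' else s) = d then i else j, snd p) else p)"

fun relabel :: "nat \<Rightarrow> nat word \<Rightarrow> nat word"
  where
    "relabel A [] = []"
  | "relabel A (p # w) =
      relabel_letter (side A (enter p)) (side (exit p) (first_vertex w)) p # relabel (exit p) w"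

text \<open>The twist conjugates the generators strictly between \<open>i\<close> and
  \<open>j\<close> by this element; a path carries it as a correction while it is on the inner
  side.\<close>

definition side_factor :: "bool \<Rightarrow> fgrp"
  where "side_factor s = (if s then if d then - gen j + gen i else gen i - gen j else 0)"

lemma length_relabel [simp]: "length (relabel A w) = length w"
  by (induction w arbitrary: A) simp_all

text \<open>The correction is moved across one letter. Along a word the corrections telescope, and
  they vanish at both ends of a path from 0 to 0, because the direction 0 is not inner.\<close>

lemma twist_letter:
  assumes "uncrossed (A, enter p)" "uncrossed (exit p, B)"
  shows "(if snd p then twist i j d (fst p) else - twist i j d (fst p)) + side_factor (side (exit p) B) =
    side_factor (side A (enter p)) + of_word [relabel_letter (side A (enter p)) (side (exit p) B) p]"
proof -
  obtain k e where p: "p = (k, e)" by (cases p)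
  define L R where "L = enter (i, \<not> d)" and "R = enter (j, \<not> d)"
  have side: "side x y \<longleftrightarrow> L < x \<and> x < R \<or> L < y \<and> y < R" for x y
    by (simp add: side_def L_def R_def)
  have unc: "L < A \<and> A < R \<longrightarrow> L \<le> enter p \<and> enter p \<le> R" "L < enter p \<and> enter p < R \<longrightarrow> L \<le> A \<and> A \<le> R"
    "L < exit p \<and> exit p < R \<longrightarrow> L \<le> B \<and> B \<le> R" "L < B \<and> B < R \<longrightarrow> L \<le> exit p \<and> exit p \<le> R"
    using assms by (simp_all add: uncrossed_def L_def R_def)
  consider "k < i \<or> j < k" | "i < k" "k < j" | "k = i" | "k = j" by linarith
  then show ?thesis
  proof cases
    case 1
    then have "enter p < L \<or> R < enter p" "exit p < L \<or> R < exit p"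
      using ij unfolding L_def R_def p by (cases e; cases d; auto)+
    then have "\<not> side A (enter p)" "\<not> side (exit p) B"
      using unc unfolding side by linarith+
    then show ?thesis using 1 ij by (auto simp: side_factor_def relabel_letter_def twist_def p of_word_letter)
  next
    case 2
    then have "L < enter p" "enter p < R" "L < exit p" "exit p < R"
      unfolding L_def R_def p by (cases e; cases d; simp)+
    then have "side A (enter p)" "side (exit p) B" unfolding side by blast+
    moreover have "twist i j d k = side_factor True + gen k - side_factor True"
      using 2 by (simp add: twist_def side_factor_def Let_def)
    moreover have "relabel_letter s s' p = p" for s s' using 2 by (simp add: relabel_letter_def p)
    ultimately show ?thesis
      by (cases e) (simp_all add: p of_word_letter add.assoc diff_conv_add_uminus minus_add
        del: add_uminus_conv_diff)
  next
    case 3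
    then have "if d then (if e = d then enter p else exit p) < L
        else L < (if e = d then enter p else exit p) \<and> (if e = d then enter p else exit p) < R"
      using ij unfolding L_def R_def p by (cases e; cases d) auto
    then have "side (if e = d then A else exit p) (if e = d then enter p else B) \<longleftrightarrow> \<not> d"
      using unc unfolding side by (cases "e = d"; cases d; simp; linarith)
    then show ?thesis
      unfolding side_factor_def relabel_letter_def twist_def Let_def p using 3 ij
      by (cases e; cases d; cases "side A (enter p)"; cases "side (exit p) B")
        (auto simp: p of_word_letter add.assoc diff_conv_add_uminus minus_add
        simp del: add_uminus_conv_diff enter.simps)
  next
    case 4
    then have "if d then L < (if e = d then enter p else exit p) \<and> (if e = d then enter p else exit p) < R
        else R < (if e = d then enter p else exit p)"
      using ij unfolding L_def R_def p by (cases e; cases d) auto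
    then have "side (if e = d then A else exit p) (if e = d then enter p else B) = d"
      using unc unfolding side by (cases "e = d"; cases d; simp; linarith)
    then show ?thesis
      unfolding side_factor_def relabel_letter_def twist_def Let_def p using 4 ij
      by (cases e; cases d; cases "side A (enter p)"; cases "side (exit p) B")
        (auto simp: p of_word_letter add.assoc diff_conv_add_uminus minus_add
        simp del: add_uminus_conv_diff enter.simps)
  qed
qed

lemma evw_twist:
  assumes "\<And>c. c \<in> chords A w \<Longrightarrow> uncrossed c"
  shows "evw (twist i j d) w = side_factor (side A (first_vertex w)) + of_word (relabel A w)"
  using assms
proof (induction w arbitrary: A)
  case Nil
  then show ?case by (auto simp: side_def side_factor_def uncrossed_def)
next
  case (Cons p w)
  have "uncrossed (A, enter p)" "uncrossed (exit p, first_vertex w)"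
    using Cons.prems chords_first[of "exit p" w] by simp_all
  from twist_letter[OF this]
  show ?case
    using Cons.IH[of "exit p"] Cons.prems
    by (simp add: of_word_Cons[of _ "relabel _ _"] flip: add.assoc)
qed

lemma ev_twist:
  assumes "\<And>c. c \<in> chords 0 (rep a) \<Longrightarrow> uncrossed c"
  shows "ev (twist i j d) a = of_word (relabel 0 (rep a))"
proof -
  have "\<not> side 0 (first_vertex (rep a))"
    using assms[OF chords_first] by (auto simp: side_def uncrossed_def)
  then show ?thesis using evw_twist[OF assms] by (simp add: ev_def side_factor_def)
qed

text \<open>The chord between \<open>p\<close> and \<open>q\<close> has both endpoints at ends of
  the arc and so is not on the inner side. Both letters consult this chord, hence they get the same
  index, with opposite signs.\<close>

lemma not_reduced_relabel:
  assumes "fst p \<in> {i, j}" "fst q \<in> {i, j}" "snd p = d" "snd q = (\<not> d)"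
  shows "\<not> reduced (relabel A (u @ p # q # v))"
proof (induction u arbitrary: A)
  case Nil
  have "exit p \<in> {enter (i, \<not> d), enter (j, \<not> d)}" "enter q \<in> {enter (i, \<not> d), enter (j, \<not> d)}"
    using assms by (cases p; cases q; force simp del: enter.simps)+
  then have "\<not> side (exit p) (enter q)" by (auto simp: side_def simp del: enter.simps)
  then show ?case using assms by (auto simp: relabel_letter_def)
next
  case (Cons x u)
  then show ?case by (auto simp: reduced_Cons)
qed

lemma length_twist:
  assumes "\<And>c. c \<in> chords 0 (rep a) \<Longrightarrow> uncrossed c"
  shows "norm_len (ev (twist i j d) a) \<le> norm_len a"
    and "rep a = u @ p # q # v \<Longrightarrow> fst p \<in> {i, j} \<Longrightarrow> fst q \<in> {i, j} \<Longrightarrow> snd p = d \<Longrightarrow> snd q = (\<not> d) \<Longrightarrow>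
      norm_len (ev (twist i j d) a) < norm_len a"
proof -
  have eq: "rep (ev (twist i j d) a) = red (relabel 0 (rep a))"
    using ev_twist[OF assms] by simp
  then show "norm_len (ev (twist i j d) a) \<le> norm_len a"
    using length_red[of "relabel 0 (rep a)"] by simp
  assume "rep a = u @ p # q # v" "fst p \<in> {i, j}" "fst q \<in> {i, j}" "snd p = d" "snd q = (\<not> d)"
  then have "\<not> reduced (relabel 0 (rep a))" using not_reduced_relabel by simp
  from length_red_less[OF this] show "norm_len (ev (twist i j d) a) < norm_len a" by (simp add: eq)
qed

lemma uncrossedI:
  assumes "\<not> linked (real A) (real B) (real (enter (i, \<not> d))) (real (enter (j, \<not> d)))"
  shows "uncrossed (A, B)"
  using not_linkedD[OF assms[unfolded linked_commute[of "real A"]]] unfolding uncrossed_def by auto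

text \<open>The arc has the same ends as a chord of the entry \<open>g k\<close>. As all entries are
  unlinked with \<open>g k\<close>, none of their chords crosses the arc.\<close>

lemma total_length_twist:
  assumes "planar n g" "k \<in> {1..n}" "rep (g k) = u @ p # q # v"
    and "{fst p, fst q} = {i, j}" "snd p = d" "snd q = (\<not> d)"
  shows "total_length n (\<lambda>k. ev (twist i j d) (g k)) < total_length n g"
proof -
  have chord: "(exit p, enter q) \<in> chords 0 (rep (g k))" unfolding assms(3) by (rule chords_append)
  have pq: "(exit p, enter q) = (enter (i, \<not> d), enter (j, \<not> d)) \<or>
      (exit p, enter q) = (enter (j, \<not> d), enter (i, \<not> d))"
    using assms(4-6) by (cases p; cases q) (auto simp: doubleton_eq_iff simp del: enter.simps)
  have unc: "uncrossed c" if c: "c \<in> chords 0 (rep (g l))" "l \<in> {1..n}" for c l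
  proof -
    obtain A B where AB: "c = (A, B)" by (cases c)
    have "point.unlinked (g l) (g k)" using assms(1,2) c(2) by (simp add: planar_def point.admissible_def)
    from chords_not_linked[OF this c(1)[unfolded AB] chord] pq
    have "\<not> linked (real A) (real B) (real (enter (i, \<not> d))) (real (enter (j, \<not> d)))"
      using linked_swap(2) by (auto simp del: enter.simps)
    then show ?thesis unfolding AB by (rule uncrossedI)
  qed
  show ?thesis
    unfolding total_length_def
  proof (rule sum_strict_mono_ex1)
    show "\<forall>l\<in>{1..n}. norm_len (ev (twist i j d) (g l)) \<le> norm_len (g l)"
      using length_twist(1) unc by blast
    have "norm_len (ev (twist i j d) (g k)) < norm_len (g k)"
      using length_twist(2)[of "g k" u p q v] unc assms(2-6) by blast
    then show "\<exists>l\<in>{1..n}. norm_len (ev (twist i j d) (g l)) < norm_len (g l)"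
      using assms(2) by blast
  qed simp
qed

end

section \<open>The action of the Birman-Ko-Lee generators\<close>

definition bkl_word :: "nat \<Rightarrow> nat \<Rightarrow> nat word"
  where "bkl_word i j =
    map (\<lambda>k. (k, True)) [i..<j - 1] @ [(j - 1, True)] @ map (\<lambda>k. (k, False)) (rev [i..<j - 1])"

lemma bkl_word_words: "1 \<le> i \<Longrightarrow> i < j \<Longrightarrow> j \<le> n \<Longrightarrow> bkl_word i j \<in> words {1..<n}"
  unfolding bkl_word_def words_def by auto (linarith+)

lemma bkl_gen_word: "bkl_gen n i j = braid_class n (bkl_word i j)"
  by (simp add: bkl_gen_def bkl_word_def)

lemma bkl_word_Suc: "bkl_word i (Suc i) = [(i, True)]"
  by (simp add: bkl_word_def)

lemma bkl_word_step:
  assumes "Suc i < j"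
  shows "bkl_word i j = (i, True) # bkl_word (Suc i) j @ [(i, False)]"
proof -
  have "i < j - 1" using assms by linarith
  from upt_conv_Cons[OF this] show ?thesis by (simp add: bkl_word_def)
qed

lemma (in group) hurwitz_bkl_word:
  assumes "1 \<le> i" "i < j" "j \<le> n" "g \<in> tuples n G"
  shows "hurwitz_word G (bkl_word i j) g = (\<lambda>k.
    if k = i then g j else if k = j then inv g j \<otimes> g i \<otimes> g j
    else if i < k \<and> k < j then (inv g j \<otimes> g i) \<otimes> g k \<otimes> inv (inv g j \<otimes> g i) else g k)"
  using assms
proof (induction "j - i" arbitrary: i g)
  case (Suc d)
  have g: "g k \<in> carrier G" if "1 \<le> k" "k \<le> n" for k
    using Suc.prems(4) that by (auto simp: tuples_def PiE_iff)
  show ?case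
  proof (cases "j = Suc i")
    case True
    then show ?thesis by (auto simp: bkl_word_Suc hurwitz_word_def fun_eq_iff)
  next
    case False
    define h where "h = hurwitz_letter G (i, False) g"
    have h: "h \<in> tuples n G"
      unfolding h_def using Suc.prems by (intro hurwitz_letter_closed[of _ n]) auto
    have "hurwitz_word G (bkl_word (Suc i) j) h = (\<lambda>k.
        if k = Suc i then h j else if k = j then inv h j \<otimes> h (Suc i) \<otimes> h j
        else if Suc i < k \<and> k < j then (inv h j \<otimes> h (Suc i)) \<otimes> h k \<otimes> inv (inv h j \<otimes> h (Suc i)) else h k)"
      using Suc.hyps(2) Suc.prems False h by (intro Suc.hyps(1)) auto
    moreover have "hurwitz_word G (bkl_word i j) g =
        hurwitz_letter G (i, True) (hurwitz_word G (bkl_word (Suc i) j) h)"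
      using Suc.prems False by (simp add: bkl_word_step h_def hurwitz_word_def)
    ultimately show ?thesis
      using Suc.prems False g[of i] g[of "Suc i"] g[of j]
      by (auto simp: h_def fun_eq_iff m_assoc inv_mult_group)
  qed
qed simp

text \<open>If \<open>g i = g j\<close>, the factor conjugating the entries in between is trivial.
  This is the reason why the Young subgroup fixes the coloured tuple.\<close>

lemma (in group) hurwitz_bkl_word_fixed:
  assumes "1 \<le> i" "i < j" "j \<le> n" "g \<in> tuples n G" "g i = g j"
  shows "hurwitz_word G (bkl_word i j) g = g"
proof -
  have g: "g k \<in> carrier G" if "1 \<le> k" "k \<le> n" for k
    using assms(4) that by (auto simp: tuples_def PiE_iff)
  show ?thesis
    using assms g by (auto simp: hurwitz_bkl_word[OF assms(1-4)] fun_eq_iff)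
qed

lemma hurwitz_word_hom:
  assumes "group G" "group H" "\<phi> \<in> hom G H" "w \<in> words {1..<n}" "g \<in> tuples n G"
  shows "hurwitz_word H w (\<lambda>k\<in>{1..n}. \<phi> (g k)) = (\<lambda>k\<in>{1..n}. \<phi> (hurwitz_word G w g k))"
  using assms(4)
proof (induction w)
  case (Cons p w)
  interpret group_hom G H \<phi> using assms by (simp add: group_hom_def group_hom_axioms_def)
  define h where "h = hurwitz_word G w g"
  have "h \<in> tuples n G" unfolding h_def using Cons.prems assms(5) by (intro G.hurwitz_word_closed) simp_all
  then have h: "h k \<in> carrier G" if "1 \<le> k" "k \<le> n" for k
    using that by (auto simp: tuples_def PiE_iff)
  obtain i e where p: "p = (i, e)" by (cases p)
  have i: "1 \<le> i" "i < n" using Cons.prems p by auto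
  have "hurwitz_letter H p (\<lambda>k\<in>{1..n}. \<phi> (h k)) = (\<lambda>k\<in>{1..n}. \<phi> (hurwitz_letter G p h k))"
    using i h[of i] h[of "Suc i"] by (cases e) (auto simp: p fun_eq_iff)
  moreover have "hurwitz_word H w (\<lambda>k\<in>{1..n}. \<phi> (g k)) = (\<lambda>k\<in>{1..n}. \<phi> (h k))"
    unfolding h_def using Cons.prems by (intro Cons.IH) simp
  moreover have "hurwitz_word G (p # w) g = hurwitz_letter G p h" by (simp add: hurwitz_word_def h_def)
  moreover have "hurwitz_word H (p # w) f = hurwitz_letter H p (hurwitz_word H w f)" for f
    by (simp add: hurwitz_word_def)
  ultimately show ?case by (simp only:)
qed (simp add: hurwitz_word_def)

lemma ev_hom: "ev f \<in> hom add_grp add_grp"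
  by (simp add: hom_def)

lemma hurwitz_word_ev:
  assumes "w \<in> words {1..<n}"
  shows "hurwitz_word add_grp w (\<lambda>k\<in>{1..n}. ev f (base n k)) = (\<lambda>k\<in>{1..n}. ev f (braid_image n w k))"
  unfolding braid_image_def
  by (rule hurwitz_word_hom[OF group_add_grp group_add_grp ev_hom assms base_tuples])

definition twist_word :: "nat \<Rightarrow> nat \<Rightarrow> bool \<Rightarrow> nat word"
  where "twist_word i j d = (if d then bkl_word i j else rev (map (apsnd Not) (bkl_word i j)))"

lemma twist_word_words: "1 \<le> i \<Longrightarrow> i < j \<Longrightarrow> j \<le> n \<Longrightarrow> twist_word i j d \<in> words {1..<n}"
  by (simp add: twist_word_def bkl_word_words del: One_nat_def)

lemma braid_image_twist_word:
  assumes "1 \<le> i" "i < j" "j \<le> n"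
  shows "braid_image n (twist_word i j d) = (\<lambda>k\<in>{1..n}. ev (twist i j d) (base n k))"
proof -
  let ?t = "\<lambda>d. \<lambda>k\<in>{1..n}. ev (twist i j d) (base n k)"
  have tuples: "?t d \<in> tuples n add_grp" for d by (simp add: tuples_def)
  have w: "bkl_word i j \<in> words {1..<n}" using assms by (rule bkl_word_words)
  note action = group.hurwitz_bkl_word[OF group_add_grp assms]
  have ijn: "i \<in> {1..n}" "j \<in> {1..n}" using assms by auto
  show ?thesis
  proof (cases d)
    case True
    have "braid_image n (bkl_word i j) k = ?t True k" for k
      unfolding braid_image_def action[OF base_tuples]
      using assms ijn by (cases "k \<in> {1..n}") (auto simp: base_def twist_def Let_def)
    then show ?thesis using True by (auto simp: twist_word_def)
  next
    case False
    let ?v = "rev (map (apsnd Not) (bkl_word i j))"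
    \<comment> \<open>The action of the inverse word is not computed: the positive word takes the
      claimed image back to the base tuple.\<close>
    have "hurwitz_word add_grp (bkl_word i j) (?t False) k = base n k" for k
      unfolding action[OF tuples]
      using assms ijn by (cases "k \<in> {1..n}")
        (auto simp: base_def twist_def Let_def add.assoc diff_conv_add_uminus minus_add simp del: add_uminus_conv_diff)
    then have "hurwitz_word add_grp (bkl_word i j) (?t False) = base n" by blast
    then have "braid_image n ?v = hurwitz_word add_grp (?v @ bkl_word i j) (?t False)"
      by (simp add: braid_image_def hurwitz_word_append)
    also have "\<dots> = ?t False"
      using group.hurwitz_word_pres_eq[OF group_add_grp pres_eq_inverse[OF w] tuples]
      by (simp add: hurwitz_word_def)
    finally show ?thesis using False by (simp add: twist_word_def)
  qed
qed

lemma braid_image_append_twist_word: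
  assumes "1 \<le> i" "i < j" "j \<le> n" "w \<in> words {1..<n}"
  shows "braid_image n (w @ twist_word i j d) = (\<lambda>k\<in>{1..n}. ev (twist i j d) (braid_image n w k))"
proof -
  have "braid_image n (w @ twist_word i j d) = hurwitz_word add_grp w (braid_image n (twist_word i j d))"
    by (simp add: braid_image_def hurwitz_word_append)
  then show ?thesis using hurwitz_word_ev[OF assms(4)] braid_image_twist_word[OF assms(1-3)] by simp
qed


section \<open>Stabilizers of colourings\<close>

definition colour_subgroup :: "nat \<Rightarrow> (nat \<Rightarrow> nat) \<Rightarrow> nat word set set"
  where "colour_subgroup n s = generate (braid_group n)
    {bkl_gen n i j | i j. 1 \<le> i \<and> i < j \<and> j \<le> n \<and> s i = s j}"

lemma subgroup_colour_subgroup: "subgroup (colour_subgroup n s) (braid_group n)"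
  unfolding colour_subgroup_def
  by (rule group.generate_is_subgroup[OF group_braid_group])
    (auto simp: bkl_gen_word intro!: braid_class_closed bkl_word_words)

lemma twist_word_colour_subgroup:
  assumes "1 \<le> i" "i < j" "j \<le> n" "s i = s j"
  shows "braid_class n (twist_word i j d) \<in> colour_subgroup n s"
proof -
  have gen: "bkl_gen n i j \<in> {bkl_gen n i j | i j. 1 \<le> i \<and> i < j \<and> j \<le> n \<and> s i = s j}"
    using assms by blast
  have w: "bkl_word i j \<in> words {1..<n}" using assms(1-3) by (rule bkl_word_words)
  show ?thesis
    using generate.incl[OF gen, of "braid_group n"] generate.inv[OF gen, of "braid_group n"]
    by (cases d) (simp_all add: colour_subgroup_def twist_word_def bkl_gen_word braid_class_winv[OF w])
qed

lemma not_successivelyE: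
  assumes "\<not> successively P w"
  obtains u p q v where "w = u @ p # q # v" "\<not> P p q"
proof -
  have "\<exists>u p q v. w = u @ p # q # v \<and> \<not> P p q"
    using assms
  proof (induction w rule: induct_list012)
    case (3 x y zs)
    show ?case
    proof (cases "P x y")
      case True
      then obtain u p q v where "y # zs = u @ p # q # v" "\<not> P p q" using 3 by auto
      then show ?thesis by (intro exI[of _ "x # u"]) auto
    next
      case False
      then show ?thesis by (intro exI[of _ "[]"]) auto
    qed
  qed auto
  then show ?thesis using that by blast
qed

lemma evw_map: "evw (\<lambda>k. gen (s k)) w = of_word (map (apfst s) w)"
proof (induction w)
  case (Cons p w)
  then show ?case
    using of_word_Cons[of "apfst s p" "map (apfst s) w"] by (cases p) (simp add: of_word_letter)
qed simp

text \<open>Without such a pair the recoloured word is still reduced, so it is the normal form of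
  \<open>gen c\<close> and has length 1.\<close>

lemma rep_eq_letterI:
  assumes "\<not> (\<exists>u p q v. rep a = u @ p # q # v \<and> s (fst p) = s (fst q) \<and> snd q = (\<not> snd p))"
    and "ev (\<lambda>k. gen (s k)) a = gen c"
  obtains k where "a = gen k"
proof -
  have "successively (\<lambda>p q. \<not> (s (fst p) = s (fst q) \<and> snd q = (\<not> snd p))) (rep a)"
  proof (rule ccontr)
    assume "\<not> ?thesis"
    then obtain u p q v where "rep a = u @ p # q # v" "s (fst p) = s (fst q) \<and> snd q = (\<not> snd p)"
      by (rule not_successivelyE) blast
    then show False using assms(1) by blast
  qed
  then have "reduced (map (apfst s) (rep a))"
    unfolding successively_map by (rule successively_mono) (auto simp: apfst_def)
  then have "map (apfst s) (rep a) = rep (gen c)"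
    using assms(2) by (metis ev_def evw_map rep_of_word red_reduced)
  then obtain k where "rep a = [(k, True)]" by auto
  then have "a = gen k" by (simp flip: rep_inject)
  then show ?thesis by (rule that)
qed

text \<open>The order of the points of a planar tuple makes the index map strictly increasing, and
  such a map from \<open>{1..n}\<close> to itself is the identity.\<close>

lemma planar_gen_tuple:
  assumes "planar n g" "\<And>k. k \<in> {1..n} \<Longrightarrow> \<exists>l. g k = gen l" "k \<in> {1..n}"
  shows "g k = gen k"
proof -
  define f where "f k = (SOME l. g k = gen l)" for k
  have f: "g k = gen (f k)" if "k \<in> {1..n}" for k
    using someI_ex[OF assms(2)[OF that]] by (simp add: f_def)
  have range: "f k \<in> {1..n}" if "k \<in> {1..n}" for k
    using assms(1) that by (auto simp: planar_def letters_in_def f)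
  have mono: "f k < f l" if "k \<in> {1..n}" "l \<in> {1..n}" "k < l" for k l
  proof (rule ccontr)
    assume "\<not> f k < f l"
    then have "f l < f k \<or> f l = f k" by linarith
    then have "point (gen (f l)) \<le> point (gen (f k))"
      using point_less[of "gen (f l)" "gen (f k)"] by (auto simp: vertex_def)
    then show False using planar_distinct(1)[OF assms(1) that] f that by simp
  qed
  have "k \<le> f k" using assms(3)
  proof (induction k)
    case (Suc k)
    then show ?case using mono[of k "Suc k"] range[of "Suc k"] by (cases "k = 0") auto
  qed simp
  moreover have "k \<le> n" using assms(3) by simp
  then have "f k \<le> k" using assms(3)
  proof (induction rule: inc_induct)
    case base
    then show ?case using range[of n] by simp
  next
    case (step k)
    then show ?case using mono[of k "Suc k"] by auto
  qed
  ultimately show ?thesis using f[OF assms(3)] by simp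
qed

text \<open>For \<open>i\<close> and \<open>j\<close> of one colour the conjugating factor of the
  twist evaluates to 0, so the induction on the length stays among braids that fix the
  colouring.\<close>

lemma ev_ev_twist:
  assumes "i < j" "s i = s j"
  shows "ev (\<lambda>k. gen (s k)) (ev (twist i j d) a) = ev (\<lambda>k. gen (s k)) a"
proof -
  have "ev (\<lambda>k. gen (s k)) (twist i j d k) = gen (s k)" for k
    using assms by (auto simp: twist_def Let_def)
  then have "ev (\<lambda>k. gen (s k)) (evw (twist i j d) w) = evw (\<lambda>k. gen (s k)) w" for w
    by (induction w) auto
  then show ?thesis by (simp add: ev_def[of "twist i j d"]) (simp add: ev_def)
qed

lemma stabilizer_colouring:
  assumes "w \<in> words {1..<n}"
    and "\<And>k. k \<in> {1..n} \<Longrightarrow> ev (\<lambda>k. gen (s k)) (braid_image n w k) = gen (s k)"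
  shows "braid_class n w \<in> colour_subgroup n s"
  using assms
proof (induction "total_length n (braid_image n w)" arbitrary: w rule: less_induct)
  case less
  note w = less.prems(1)
  have planar: "planar n (braid_image n w)" using w by (rule planar_braid_image)
  show ?case
  proof (cases "\<exists>k\<in>{1..n}. \<exists>u p q v. rep (braid_image n w k) = u @ p # q # v \<and>
      s (fst p) = s (fst q) \<and> snd q = (\<not> snd p)")
    case True
    then obtain k u p q v where k: "k \<in> {1..n}" and rep: "rep (braid_image n w k) = u @ p # q # v"
        and s: "s (fst p) = s (fst q)" and d: "snd q = (\<not> snd p)" by blast
    have "braid_image n w k \<in> letters_in {1..n}" using planar k by (simp add: planar_def)
    then have range: "fst p \<in> {1..n}" "fst q \<in> {1..n}" by (simp_all add: letters_in_def rep)
    have "reduced (p # q # v)" using reduced_rep[of "braid_image n w k"] unfolding rep by (simp add: reduced_append)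
    then have "fst p \<noteq> fst q" using d by (cases p; cases q) auto
    \<comment> \<open>The two letters may come in either order of indices; the sign of the first one
      selects the half twist or its inverse.\<close>
    define i j where "i = min (fst p) (fst q)" and "j = max (fst p) (fst q)"
    have ij: "1 \<le> i" "i < j" "j \<le> n" "s i = s j" "{fst p, fst q} = {i, j}"
      using range s \<open>fst p \<noteq> fst q\<close> by (auto simp: i_def j_def min_def max_def)
    let ?t = "twist_word i j (snd p)"
    have t: "?t \<in> words {1..<n}" using ij(1-3) by (rule twist_word_words)
    have image: "braid_image n (w @ ?t) = (\<lambda>k\<in>{1..n}. ev (twist i j (snd p)) (braid_image n w k))"
      using ij(1-3) w by (rule braid_image_append_twist_word)
    have "braid_class n (w @ ?t) \<in> colour_subgroup n s"
    proof (rule less.hyps)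
      have "total_length n (braid_image n (w @ ?t)) =
          total_length n (\<lambda>k. ev (twist i j (snd p)) (braid_image n w k))"
        by (simp add: image total_length_def)
      also have "\<dots> < total_length n (braid_image n w)"
        using ij(2) planar k rep ij(5) HOL.refl d by (rule total_length_twist)
      finally show "total_length n (braid_image n (w @ ?t)) < total_length n (braid_image n w)" .
      show "w @ ?t \<in> words {1..<n}" using w t by simp
      show "ev (\<lambda>k. gen (s k)) (braid_image n (w @ ?t) k) = gen (s k)" if "k \<in> {1..n}" for k
        using less.prems(2)[OF that] that ev_ev_twist[OF ij(2,4)] by (simp add: image)
    qed
    moreover have "braid_class n ?t \<in> colour_subgroup n s"
      using ij(1-4) by (rule twist_word_colour_subgroup)
    moreover interpret B: group "braid_group n" by (rule group_braid_group)
    have "braid_class n w = braid_class n (w @ ?t) \<otimes>\<^bsub>braid_group n\<^esub> inv\<^bsub>braid_group n\<^esub> braid_class n ?t"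
      using w t braid_class_closed[of _ n] by (simp add: braid_class_append B.m_assoc del: One_nat_def)
    ultimately show ?thesis
      using subgroup.m_closed[OF subgroup_colour_subgroup] subgroup.m_inv_closed[OF subgroup_colour_subgroup]
      by metis
  next
    case False
    then have "\<exists>l. braid_image n w k = gen l" if "k \<in> {1..n}" for k
      using rep_eq_letterI[of "braid_image n w k" s "s k"] less.prems(2)[OF that] that by metis
    then have "braid_image n w k = base n k" if "k \<in> {1..n}" for k
      using planar_gen_tuple[OF planar _ that] that by (simp add: base_apply)
    then have "braid_image n w = base n"
      by (rule PiE_ext[OF braid_image_tuples[OF w, unfolded tuples_def] base_tuples[unfolded tuples_def]])
    then have "braid_class n w = \<one>\<^bsub>braid_group n\<^esub>"
      using braid_image_base_imp_trivial[OF w] braid_eq_iff[OF w] by (simp add: braid_class_Nil)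
    then show ?thesis using subgroup.one_closed[OF subgroup_colour_subgroup] by simp
  qed
qed

section \<open>Passage from the presented free group to reduced words\<close>

definition reduce_class :: "nat word set \<Rightarrow> fgrp"
  where "reduce_class A = of_word (SOME w. w \<in> A)"

lemma reduce_class:
  assumes "w \<in> words X"
  shows "reduce_class (word_class X {} w) = of_word w"
proof -
  have "w \<in> word_class X {} w" using assms by (simp add: word_class_def pres_eq.refl)
  then have "(SOME v. v \<in> word_class X {} w) \<in> word_class X {} w" by (rule someI)
  then have "pres_eq X {} w (SOME v. v \<in> word_class X {} w)" by (simp add: word_class_def)
  from pres_eq_red[OF this] show ?thesis by (simp add: reduce_class_def of_word_eq_iff)
qed

lemma reduce_class_hom: "reduce_class \<in> hom (free_group X) add_grp"
proof (rule homI)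
  fix A B assume "A \<in> carrier (free_group X)" "B \<in> carrier (free_group X)"
  then obtain v w where "A = word_class X {} v" "v \<in> words X" "B = word_class X {} w" "w \<in> words X"
    by (auto simp: free_group_def presented_group_def)
  then show "reduce_class (A \<otimes>\<^bsub>free_group X\<^esub> B) = reduce_class A \<otimes>\<^bsub>add_grp\<^esub> reduce_class B"
    by (simp add: free_group_def presented_group_mult reduce_class of_word_append)
qed simp

lemma reduce_class_free_gen: "x \<in> X \<Longrightarrow> reduce_class (free_gen X x) = gen x"
  by (simp add: free_gen_def reduce_class gen_def)

theorem theorem1p2:
  fixes n m :: nat and Q :: "nat \<Rightarrow> nat set" and t :: "nat \<Rightarrow> nat word set"
  assumes "n \<ge> 1"
    and "partition_on {1..n} (Q ` {1..m})"
    and "inj_on Q {1..m}"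
    and "t \<in> tuples n (free_group {1..m})"
    and "\<forall>i\<in>{1..n}. \<forall>s\<in>{1..m}. t i = free_gen {1..m} s \<longleftrightarrow> i \<in> Q s"
  shows "young_subgroup n (Q ` {1..m}) =
    stabilizer (braid_group n) (hurwitz_action n (free_group {1..m})) t"
proof
  interpret F: group "free_group {1..m}" by (rule group_free_group)
  interpret A: group_action "braid_group n" "tuples n (free_group {1..m})" "hurwitz_action n (free_group {1..m})"
    by (rule F.hurwitz_group_action)
  have "\<exists>s\<in>{1..m}. i \<in> Q s" if "i \<in> {1..n}" for i
    using partition_onD1[OF assms(2)] that by auto
  then obtain s where s: "\<And>i. i \<in> {1..n} \<Longrightarrow> s i \<in> {1..m} \<and> i \<in> Q (s i)" by metis
  have t: "t i = free_gen {1..m} (s i)" if "i \<in> {1..n}" for i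
    using assms(5) s[OF that] that by blast
  have same: "s i = s j \<longleftrightarrow> t i = t j" if "i \<in> {1..n}" "j \<in> {1..n}" for i j
    using t that s free_gen_inj by (metis inj_onD)
  have part: "(\<exists>A\<in>Q ` {1..m}. i \<in> A \<and> j \<in> A) \<longleftrightarrow> s i = s j" if "i \<in> {1..n}" "j \<in> {1..n}" for i j
  proof
    assume "\<exists>A\<in>Q ` {1..m}. i \<in> A \<and> j \<in> A"
    then obtain c where "c \<in> {1..m}" "i \<in> Q c" "j \<in> Q c" by blast
    then have "t i = t j" using assms(5) that by metis
    then show "s i = s j" using same that by simp
  next
    assume "s i = s j"
    then have "i \<in> Q (s i)" "j \<in> Q (s i)" "s i \<in> {1..m}" using s[OF that(1)] s[OF that(2)] by simp_all
    then show "\<exists>A\<in>Q ` {1..m}. i \<in> A \<and> j \<in> A" by blast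
  qed
  have young: "young_subgroup n (Q ` {1..m}) = colour_subgroup n s"
    unfolding young_subgroup_def colour_subgroup_def
  proof -
    have "1 \<le> i \<and> i < j \<and> j \<le> n \<and> (\<exists>A\<in>Q ` {1..m}. i \<in> A \<and> j \<in> A) \<longleftrightarrow> 1 \<le> i \<and> i < j \<and> j \<le> n \<and> s i = s j"
      for i j
    proof (cases "1 \<le> i \<and> i < j \<and> j \<le> n")
      case True
      then show ?thesis using part[of i j] by simp
    qed blast
    then show "generate (braid_group n)
        {bkl_gen n i j | i j. 1 \<le> i \<and> i < j \<and> j \<le> n \<and> (\<exists>A\<in>Q ` {1..m}. i \<in> A \<and> j \<in> A)} =
      generate (braid_group n) {bkl_gen n i j | i j. 1 \<le> i \<and> i < j \<and> j \<le> n \<and> s i = s j}"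
      by (simp only:)
  qed
  show "young_subgroup n (Q ` {1..m}) \<subseteq> stabilizer (braid_group n) (hurwitz_action n (free_group {1..m})) t"
    unfolding young colour_subgroup_def
  proof (rule group.generate_subgroup_incl[OF group_braid_group])
    show "{bkl_gen n i j | i j. 1 \<le> i \<and> i < j \<and> j \<le> n \<and> s i = s j}
        \<subseteq> stabilizer (braid_group n) (hurwitz_action n (free_group {1..m})) t"
    proof clarify
      fix i j assume ij: "1 \<le> i" "i < j" "j \<le> n" and "s i = s j"
      then have "t i = t j" using same[of i j] by simp
      then have "hurwitz_word (free_group {1..m}) (bkl_word i j) t = t"
        by (rule F.hurwitz_bkl_word_fixed[OF ij assms(4)])
      then show "bkl_gen n i j \<in> stabilizer (braid_group n) (hurwitz_action n (free_group {1..m})) t"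
        using bkl_word_words[OF ij] assms(4)
        by (simp add: stabilizer_def bkl_gen_word braid_class_closed F.hurwitz_action_class del: One_nat_def)
    qed
    show "subgroup (stabilizer (braid_group n) (hurwitz_action n (free_group {1..m})) t) (braid_group n)"
      using assms(4) by (rule A.stabilizer_subgroup)
  qed
  show "stabilizer (braid_group n) (hurwitz_action n (free_group {1..m})) t \<subseteq> young_subgroup n (Q ` {1..m})"
  proof
    fix \<beta> assume "\<beta> \<in> stabilizer (braid_group n) (hurwitz_action n (free_group {1..m})) t"
    then have "\<beta> \<in> carrier (braid_group n)" and fixed: "hurwitz_action n (free_group {1..m}) \<beta> t = t"
      by (simp_all add: stabilizer_def)
    then obtain w where w: "w \<in> words {1..<n}" "\<beta> = braid_class n w"
      unfolding braid_group_def presented_group_def braid_class_def by auto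
    have "hurwitz_word (free_group {1..m}) w t = t"
      using fixed F.hurwitz_action_class[OF w(1) assms(4)] by (simp only: w(2))
    \<comment> \<open>The reduced form of \<open>t\<close> is the base tuple evaluated at the
      colours. Naturality of the Hurwitz action on both sides then turns the fixing of
      \<open>t\<close> into a condition on \<open>braid_image n w\<close>.\<close>
    have image: "(\<lambda>k\<in>{1..n}. reduce_class (t k)) = (\<lambda>k\<in>{1..n}. ev (\<lambda>k. gen (s k)) (base n k))"
      using t s by (auto simp: reduce_class_free_gen base_apply fun_eq_iff)
    have "(\<lambda>k\<in>{1..n}. ev (\<lambda>k. gen (s k)) (braid_image n w k)) = (\<lambda>k\<in>{1..n}. reduce_class (t k))"
      using hurwitz_word_hom[OF F.is_group group_add_grp reduce_class_hom w(1) assms(4)]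
        hurwitz_word_ev[OF w(1), of "\<lambda>k. gen (s k)"] \<open>hurwitz_word (free_group {1..m}) w t = t\<close> image by simp
    then have "ev (\<lambda>k. gen (s k)) (braid_image n w k) = gen (s k)" if "k \<in> {1..n}" for k
      using that t s by (metis (no_types, lifting) restrict_apply' reduce_class_free_gen)
    then show "\<beta> \<in> young_subgroup n (Q ` {1..m})"
      unfolding young w(2) using w(1) by (intro stabilizer_colouring)
  qed
qed

end
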